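(* Let $1<p\le q<\infty$, let $q'$ be defined by $1/q+1/q'=1$, and let $\mu$ be a positive Borel measure on $[0,1)$ which is a $1$-Carleson measure. (i) For any $\gamma>0$: if $\mu$ is a vanishing $(1/p+1/q'+1+\gamma)$-Carleson measure, then $\mathcal{DH}_\mu$ is a compact operator from $H^p$ into $H^q$. (ii) If $\mathcal{DH}_\mu$ is a compact operator from $H^p$ into $H^q$, then $\mu$ is a vanishing $(1/p+1/q'+1)$-Carleson measure.
   Context: $\mathbb{D}$ is the open unit disc in $\mathbb{C}$. For $0<p<\infty$, the Hardy space $H^p$ consists of all analytic $f$ on $\mathbb{D}$ with $\|f\|_{H^p}=\sup_{0<r<1}\left(\frac1{2\pi}\int_0^{2\pi}|f(re^{i\theta})|^p\,d\theta\right)^{1/p}<\infty$. For a positive Borel measure $\mu$ on $[0,1)$, let $\mu_n=\int_{[0,1)}t^n\,d\mu(t)$, and for $f(z)=\sum_{k=0}^\infty a_kz^k$ analytic on $\mathbb{D}$ put $$\mathcal{DH}_\mu(f)(z)=\sum_{n=0}^\infty (n+1)\Big(\sum_{k=0}^\infty \mu_{n+k}a_k\Big)z^n .$$ When $1<p<\infty$ and $\mu$ is a $1$-Carleson measure, this is a well-defined analytic function on $\mathbb{D}$ for every $f\in H^p$. For $s>0$, a positive Borel measure $\mu$ on $[0,1)$ is an $s$-Carleson measure if there is a constant $C>0$ with $\mu([t,1))\le C(1-t)^s$ for all $0\le t<1$; it is a vanishing $s$-Carleson measure if moreover $\lim_{t\to1^-}\mu([t,1))/(1-t)^s=0$. 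*)

theory Defs
  imports "HOL-Complex_Analysis.Complex_Analysis"
begin

definition integral_mean :: "real \<Rightarrow> (complex \<Rightarrow> complex) \<Rightarrow> real \<Rightarrow> real" where
  "integral_mean p f r =
     (1 / (2 * pi) * integral {0..2 * pi} (\<lambda>\<theta>. norm (f (of_real r * cis \<theta>)) powr p)) powr (1 / p)"

text \<open>
  Analytic functions on the unit disc are represented by functions on the whole complex plane
  whose values off the disc are irrelevant: nothing below depends on them.
\<close>

definition hardy_space :: "real \<Rightarrow> (complex \<Rightarrow> complex) set" where
  "hardy_space p =
     {f. f holomorphic_on ball 0 1 \<and> bdd_above (integral_mean p f ` {0<..<1})}"

text \<open>The real-valued supremum is the intended one only for members of \<^const>\<open>hardy_space\<close>.\<close>

definition hardy_norm :: "real \<Rightarrow> (complex \<Rightarrow> complex) \<Rightarrow> real" where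
  "hardy_norm p f = (SUP r\<in>{0<..<1}. integral_mean p f r)"

definition moment :: "real measure \<Rightarrow> nat \<Rightarrow> real" where
  "moment \<mu> n = (\<integral>t. t ^ n \<partial>\<mu>)"

definition taylor_coeff :: "(complex \<Rightarrow> complex) \<Rightarrow> nat \<Rightarrow> complex" where
  "taylor_coeff f k = (deriv ^^ k) f 0 / fact k"

definition DH :: "real measure \<Rightarrow> (complex \<Rightarrow> complex) \<Rightarrow> complex \<Rightarrow> complex" where
  "DH \<mu> f z =
     (\<Sum>n. of_nat (n + 1) * (\<Sum>k. of_real (moment \<mu> (n + k)) * taylor_coeff f k) * z ^ n)"

definition carleson :: "real \<Rightarrow> real measure \<Rightarrow> bool" where
  "carleson s \<mu> \<longleftrightarrow>
     (\<exists>C>0. \<forall>t\<in>{0..<1}. emeasure \<mu> {t..<1} \<le> ennreal (C * (1 - t) powr s))"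

text \<open>
  The real-valued \<^const>\<open>measure\<close> is harmless in the limit, since the first
  conjunct makes all the masses finite.
\<close>

definition vanishing_carleson :: "real \<Rightarrow> real measure \<Rightarrow> bool" where
  "vanishing_carleson s \<mu> \<longleftrightarrow>
     carleson s \<mu> \<and> ((\<lambda>t. measure \<mu> {t..<1} / (1 - t) powr s) \<longlongrightarrow> 0) (at_left 1)"

text \<open>
  A linear map between the Hardy spaces, with functions identified when they agree on the disc,
  under which the image of every bounded sequence has a subsequence converging in norm.
\<close>

definition compact_operator_hardy ::
    "real \<Rightarrow> real \<Rightarrow> ((complex \<Rightarrow> complex) \<Rightarrow> complex \<Rightarrow> complex) \<Rightarrow> bool" where
  "compact_operator_hardy p q T \<longleftrightarrow>
     (\<forall>f\<in>hardy_space p. T f \<in> hardy_space q) \<and>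
     (\<forall>f\<in>hardy_space p. \<forall>g\<in>hardy_space p. \<forall>a b. \<forall>z\<in>ball 0 1.
        T (\<lambda>w. a * f w + b * g w) z = a * T f z + b * T g z) \<and>
     (\<forall>F :: nat \<Rightarrow> complex \<Rightarrow> complex.
        (\<forall>n. F n \<in> hardy_space p) \<and> (\<exists>M. \<forall>n. hardy_norm p (F n) \<le> M) \<longrightarrow>
        (\<exists>r g. strict_mono r \<and> g \<in> hardy_space q \<and>
           (\<lambda>n. hardy_norm q (\<lambda>z. T (F (r n)) z - g z)) \<longlonglongrightarrow> 0))"

end

theory Submission
  imports Defs
begin

text \<open>
  Summing the series gives \<open>DH \<mu> f z = \<integral> f(t) / (1 - t z)\<^sup>2 \<partial>\<mu>(t)\<close>. The Poisson formula yields both the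
  growth estimate \<open>\<bar>f(z)\<bar> \<le> (2 / (1 - \<bar>z\<bar>))\<^bsup>1/p\<^esup> \<parallel>f\<parallel>\<close> and
  \<open>\<parallel>(1 - t z)\<^bsup>-2\<^esup>\<parallel>\<^sub>q \<le> (1 - t)\<^bsup>1/q - 2\<^esup>\<close>, so by Minkowski's integral inequality the norm of
  \<open>DH \<mu> f\<close> in \<open>H\<^sup>q\<close> is at most \<open>\<integral> \<bar>f(t)\<bar> (1 - t)\<^bsup>1/q - 2\<^esup> \<partial>\<mu>(t)\<close>. The extra \<open>\<gamma>\<close> makes
  \<open>(1 - t)\<^bsup>-(1/p + 2 - 1/q)\<^esup>\<close> integrable, and then compactness is Montel's theorem together with
  dominated convergence. Conversely, the normalised functions
  \<open>f\<^sub>a(z) = (1 - a)\<^bsup>2 - 1/p\<^esup> / (1 - a z)\<^sup>2\<close> have images tending to 0 pointwise as \<open>a \<rightarrow> 1\<close>, so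
  compactness forces their norms in \<open>H\<^sup>q\<close> to tend to 0; the growth estimate for \<open>DH \<mu> f\<^sub>a\<close> at the
  point \<open>a\<close> bounds \<open>\<mu>([a, 1))\<close> by a multiple of \<open>(1 - a)\<^bsup>1/p + 2 - 1/q\<^esup>\<close> times these norms.
\<close>

section \<open>Convexity of powers and a weighted Jensen inequality\<close>

lemma powr_tangent:
  fixes x y p :: real
  assumes "x \<ge> 0" "y \<ge> 0" "p \<ge> 1"
  shows "y powr p + p * y powr (p - 1) * (x - y) \<le> x powr p"
proof (cases "x = 0 \<or> y = 0")
  case True
  then show ?thesis
  proof
    assume [simp]: "x = 0"
    have "y powr (p - 1) * y = y powr p"
      using assms by (cases "y = 0") (auto simp: powr_mult_base mult.commute)
    then have "p * y powr (p - 1) * (x - y) = - (p * y powr p)"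
      by simp
    moreover have "1 * y powr p \<le> p * y powr p"
      using assms by (intro mult_right_mono) auto
    ultimately show ?thesis using assms by (simp add: mult.assoc)
  next
    \<comment> \<open>Since \<open>0 powr s = 0\<close> for every exponent, the left side is 0, also
      in the case p = 1.\<close>
    assume "y = 0"
    then show ?thesis by simp
  qed
next
  case False
  with assms have x: "x > 0" and y: "y > 0" by auto
  \<comment> \<open>Bernoulli's inequality, obtained from Young's inequality for (x / y)^p and 1
    with the weights 1/p and 1 - 1/p. By homogeneity, multiplying by y^p turns it into the tangent
    inequality at y.\<close>
  have "1 + p * (x / y - 1) \<le> (x / y) powr p"
  proof -
    have "x / y \<le> (1 / p) * (x / y) powr p + (1 - 1 / p)"
      using Youngs_inequality_0[of "1 / p" "1 - 1 / p" "(x / y) powr p" 1] assms x y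
      by (simp add: powr_powr)
    then have "p * (x / y) \<le> p * ((1 / p) * (x / y) powr p + (1 - 1 / p))"
      using assms by (intro mult_left_mono) auto
    also have "\<dots> = (x / y) powr p + p - 1"
      using assms by (simp add: distrib_left right_diff_distrib)
    finally show ?thesis by (simp add: right_diff_distrib)
  qed
  then have "y powr p * (1 + p * (x / y - 1)) \<le> y powr p * (x / y) powr p"
    by (intro mult_left_mono) auto
  also have "\<dots> = x powr p"
    using x y by (simp add: powr_mult [symmetric])
  also have "y powr p * (1 + p * (x / y - 1)) = y powr p + p * y powr (p - 1) * (x - y)"
    using y by (simp add: powr_diff field_simps)
  finally show ?thesis .
qed

text \<open>Jensen's inequality for a weight of arbitrary total mass: the tangent inequality at the
  weighted mean of \<open>k\<close> is integrated against \<open>v\<close>. It serves twice, with a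
  Poisson kernel as weight for point evaluation and with a weight on [0,1) for Minkowski's
  inequality.\<close>

lemma weighted_jensen_powr:
  fixes v k :: "'a \<Rightarrow> real"
  assumes p: "p \<ge> 1" and v: "\<And>x. x \<in> space M \<Longrightarrow> v x \<ge> 0" and k: "\<And>x. x \<in> space M \<Longrightarrow> k x \<ge> 0"
    and int: "integrable M v" "integrable M (\<lambda>x. v x * k x)" "integrable M (\<lambda>x. v x * k x powr p)"
  shows "(\<integral>x. v x * k x \<partial>M) powr p \<le> (\<integral>x. v x \<partial>M) powr (p - 1) * (\<integral>x. v x * k x powr p \<partial>M)"
proof -
  define A where "A = (\<integral>x. v x \<partial>M)"
  define B where "B = (\<integral>x. v x * k x \<partial>M)"
  have A0: "A \<ge> 0" and B0: "B \<ge> 0"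
    unfolding A_def B_def by (intro integral_nonneg_AE AE_I2; use v k in simp)+
  show ?thesis
  proof (cases "A = 0")
    case True
    have "AE x in M. v x = 0"
      using True integral_nonneg_eq_0_iff_AE[OF int(1)] v unfolding A_def by auto
    then have "AE x in M. v x * k x = 0" by eventually_elim auto
    then have "B = 0" unfolding B_def by (rule integral_eq_zero_AE)
    then show ?thesis
      unfolding B_def[symmetric] using p v by (auto intro!: mult_nonneg_nonneg integral_nonneg_AE)
  next
    case False
    with A0 have A: "A > 0" by simp
    define J where "J = B / A"
    have J0: "J \<ge> 0" unfolding J_def using A B0 by simp
    have "(\<integral>x. v x * (J powr p) + p * J powr (p - 1) * (v x * k x - J * v x) \<partial>M) \<le> (\<integral>x. v x * k x powr p \<partial>M)"
    proof (rule integral_mono)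
      fix x assume x: "x \<in> space M"
      have "v x * (J powr p + p * J powr (p - 1) * (k x - J)) \<le> v x * k x powr p"
        using x v k J0 p by (intro mult_left_mono powr_tangent) auto
      then show "v x * (J powr p) + p * J powr (p - 1) * (v x * k x - J * v x) \<le> v x * k x powr p"
        by (simp add: algebra_simps)
    qed (use int in auto)
    also have "(\<integral>x. v x * (J powr p) + p * J powr (p - 1) * (v x * k x - J * v x) \<partial>M)
        = A * J powr p + p * J powr (p - 1) * (B - J * A)"
      unfolding A_def B_def using int by simp
    \<comment> \<open>The linear term drops out because \<open>J\<close> is the weighted
      mean.\<close>
    also have "\<dots> = A * J powr p" using A by (simp add: J_def)
    finally have "A powr (p - 1) * (A * J powr p) \<le> A powr (p - 1) * (\<integral>x. v x * k x powr p \<partial>M)"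
      by (intro mult_left_mono) auto
    moreover have "A powr (p - 1) * (A * J powr p) = B powr p"
      using A B0 by (simp add: J_def powr_divide powr_diff)
    ultimately show ?thesis by (simp add: A_def B_def)
  qed
qed

section \<open>Integral means as Lebesgue integrals over the circle\<close>

definition circle :: "real measure" where
  "circle = restrict_space lborel {0..2 * pi}"

lemma space_circle [simp]: "space circle = {0..2 * pi}"
  by (simp add: circle_def space_restrict_space)

lemma finite_measure_circle: "finite_measure circle"
  by (rule finite_measureI) (simp add: circle_def emeasure_restrict_space space_restrict_space)

lemma integrable_circle:
  fixes u :: "real \<Rightarrow> 'a::euclidean_space"
  assumes "continuous_on {0..2 * pi} u"
  shows "integrable circle u"
  using borel_integrable_atLeastAtMost'[OF assms]
  by (simp add: circle_def integrable_restrict_space set_integrable_def)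

lemma integral_circle:
  fixes u :: "real \<Rightarrow> 'a::euclidean_space"
  assumes "continuous_on {0..2 * pi} u"
  shows "integral\<^sup>L circle u = integral {0..2 * pi} u"
  using set_borel_integral_eq_integral(2)[OF borel_integrable_atLeastAtMost'[OF assms]]
  by (simp add: circle_def integral_restrict_space set_lebesgue_integral_def)

lemma continuous_on_circle_mean:
  assumes "continuous_on (sphere 0 r) f" "r \<ge> 0" "p > 0"
  shows "continuous_on A (\<lambda>\<theta>. norm (f (of_real r * cis \<theta>)) powr p)"
proof -
  have "continuous_on A (\<lambda>\<theta>. f (of_real r * cis \<theta>))"
    by (rule continuous_on_compose2[OF assms(1)]) (use assms(2) in \<open>auto intro!: continuous_intros simp: norm_mult\<close>)
  then show ?thesis using assms(3) by (intro continuous_on_powr' continuous_intros) auto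
qed

lemma continuous_on_sphere_if_holomorphic:
  assumes "f holomorphic_on ball 0 1" "r < 1"
  shows "continuous_on (sphere 0 r) f"
  by (rule continuous_on_subset[OF holomorphic_on_imp_continuous_on[OF assms(1)]]) (use assms(2) in auto)

text \<open>The means are defined by the gauge integral. On a circle inside the disc the integrand
  is continuous, so the Lebesgue integral agrees with it, and Jensen and Fubini become available.
  The measure \<open>circle\<close> has total mass 2 pi, whence the division.\<close>

lemma integral_mean_powr:
  assumes "f holomorphic_on ball 0 1" "0 \<le> r" "r < 1" "p > 0"
  shows "integral_mean p f r powr p = (\<integral>\<theta>. norm (f (of_real r * cis \<theta>)) powr p \<partial>circle) / (2 * pi)"
proof -
  have c: "continuous_on {0..2*pi} (\<lambda>\<theta>. norm (f (of_real r * cis \<theta>)) powr p)"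
    using assms by (intro continuous_on_circle_mean continuous_on_sphere_if_holomorphic)
  have "integral {0..2 * pi} (\<lambda>\<theta>. norm (f (of_real r * cis \<theta>)) powr p) \<ge> 0"
    by (intro integral_nonneg integrable_continuous_interval c) auto
  then show ?thesis
    using assms unfolding integral_mean_def integral_circle[OF c] by (simp add: powr_powr)
qed

lemma integral_mean_leI:
  assumes "f holomorphic_on ball 0 1" "0 \<le> r" "r < 1" "p > 0" "B \<ge> 0"
    and "(\<integral>\<theta>. norm (f (of_real r * cis \<theta>)) powr p \<partial>circle) \<le> 2 * pi * B powr p"
  shows "integral_mean p f r \<le> B"
proof -
  have "integral_mean p f r powr p \<le> B powr p"
    unfolding integral_mean_powr[OF assms(1-4)] using assms(6) by (simp add: field_simps)
  moreover have "integral_mean p f r \<ge> 0" by (simp add: integral_mean_def)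
  ultimately show ?thesis using assms(4,5) by (meson powr_less_mono2 not_le)
qed

section \<open>Poisson's formula on the unit circle\<close>

lemma poisson_circle:
  fixes f :: "complex \<Rightarrow> complex"
  assumes f: "f holomorphic_on ball 0 R" and R: "R > 1" and z: "norm z < 1"
  shows "((\<lambda>\<theta>. f (cis \<theta>) / of_real ((norm (1 - cnj z * cis \<theta>))\<^sup>2))
           has_integral (2 * pi * f z / of_real (1 - (norm z)\<^sup>2))) {0..2 * pi}"
proof -
  \<comment> \<open>On the unit circle \<open>(1 - cnj z * w) * (w - z) / w\<close> is \<open>\<bar>1 - cnj z * w\<bar>\<^sup>2\<close>, so Cauchy's formula for
    this function is Poisson's formula for \<open>f\<close>.\<close>
  define F where "F = (\<lambda>w. f w / (1 - cnj z * w))"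
  have nz: "1 - cnj z * w \<noteq> 0" if "w \<in> cball 0 1" for w
  proof
    assume "1 - cnj z * w = 0"
    then have "norm (cnj z * w) = 1" by simp
    moreover have "norm (cnj z * w) \<le> norm z * 1"
      unfolding norm_mult complex_mod_cnj using that by (intro mult_left_mono) auto
    ultimately show False using z by simp
  qed
  have hol: "F holomorphic_on cball 0 1"
    unfolding F_def using nz R
    by (intro holomorphic_intros holomorphic_on_subset[OF f]) auto
  have "((\<lambda>u. F u / (u - z)) has_contour_integral (2 * of_real pi * \<i> * F z)) (circlepath 0 1)"
    using z by (intro Cauchy_integral_circlepath holomorphic_on_imp_continuous_on hol
        holomorphic_on_subset[OF hol]) auto
  then have "((\<lambda>t. F (cis t) / (cis t - z) * \<i> * cis t) has_integral (2 * of_real pi * \<i> * F z)) {0..2 * pi}"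
    unfolding circlepath_def by (subst (asm) has_contour_integral_part_circlepath_iff) auto
  from has_integral_mult_right[OF this, of "-\<i>"]
  have *: "((\<lambda>t. F (cis t) / (cis t - z) * cis t) has_integral (2 * of_real pi * F z)) {0..2 * pi}"
    by (simp add: algebra_simps)
  have eq: "F (cis t) / (cis t - z) * cis t = f (cis t) / of_real ((norm (1 - cnj z * cis t))\<^sup>2)" for t
  proof -
    have "of_real ((norm (1 - cnj z * cis t))\<^sup>2) = (1 - cnj z * cis t) * cnj (1 - cnj z * cis t)"
      by (rule complex_norm_square)
    also have "cnj (1 - cnj z * cis t) = (cis t - z) / cis t"
      by (simp add: cis_cnj field_simps cis_inverse[symmetric])
    finally show ?thesis by (simp add: F_def)
  qed
  have eq2: "F z = f z / of_real (1 - (norm z)\<^sup>2)"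
  proof -
    have "of_real ((norm z)\<^sup>2) = z * cnj z" by (rule complex_norm_square)
    then show ?thesis by (simp add: F_def mult.commute)
  qed
  show ?thesis using * unfolding eq eq2 by simp
qed

subsection \<open>Point evaluation on Hardy spaces\<close>

lemma norm_kernel_ge:
  fixes z w :: complex
  assumes "norm w \<le> 1"
  shows "1 - norm z \<le> norm (1 - z * w)"
proof -
  have "norm (z * w) \<le> norm z * 1"
    unfolding norm_mult using assms by (intro mult_left_mono) auto
  then show ?thesis using norm_triangle_ineq2[of 1 "z * w"] by simp
qed

text \<open>Poisson's formula for the constant function 1, taken at \<open>cnj z\<close> because the
  kernel there contains the conjugate of the point.\<close>

lemma poisson_kernel_circle:
  assumes z: "norm z < 1"
  shows "continuous_on A (\<lambda>\<theta>. 1 / (norm (1 - z * cis \<theta>))\<^sup>2)"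
    and "(\<integral>\<theta>. 1 / (norm (1 - z * cis \<theta>))\<^sup>2 \<partial>circle) = 2 * pi / (1 - (norm z)\<^sup>2)"
proof -
  have nz: "norm (1 - z * cis \<theta>) \<noteq> 0" for \<theta>
    using norm_kernel_ge[of "cis \<theta>" z] z by auto
  show c: "continuous_on A (\<lambda>\<theta>. 1 / (norm (1 - z * cis \<theta>))\<^sup>2)" for A
    using nz by (intro continuous_intros) auto
  have "((\<lambda>\<theta>. complex_of_real (1 / (norm (1 - z * cis \<theta>))\<^sup>2)) has_integral 
          complex_of_real (2 * pi / (1 - (norm z)\<^sup>2))) {0..2 * pi}"
    using poisson_circle[of "\<lambda>_. 1" 2 "cnj z"] z by simp
  then have "((\<lambda>\<theta>. 1 / (norm (1 - z * cis \<theta>))\<^sup>2) has_integral (2 * pi / (1 - (norm z)\<^sup>2))) {0..2 * pi}"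
    by (auto dest: has_integral_Re simp del: of_real_divide of_real_power of_real_mult)
  then show "(\<integral>\<theta>. 1 / (norm (1 - z * cis \<theta>))\<^sup>2 \<partial>circle) = 2 * pi / (1 - (norm z)\<^sup>2)"
    unfolding integral_circle[OF c] by (rule integral_unique)
qed

text \<open>The exponent -2p is split as (2 - 2p) + (-2). The first part is nonpositive and is
  estimated pointwise by the lower bound 1 - |z| of the kernel; the second is a Poisson kernel,
  whose integral costs one further power of 1 - |z|.\<close>

lemma kernel_power_mean:
  assumes z: "norm z < 1" and p: "p \<ge> 1"
  shows "continuous_on A (\<lambda>\<theta>. norm (1 - z * cis \<theta>) powr (- 2 * p))"
    and "(\<integral>\<theta>. norm (1 - z * cis \<theta>) powr (- 2 * p) \<partial>circle) \<le> 2 * pi * (1 - norm z) powr (1 - 2 * p)"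
proof -
  have pos: "1 - norm z \<le> norm (1 - z * cis \<theta>)" for \<theta>
    by (rule norm_kernel_ge) simp
  have pos': "norm (1 - z * cis \<theta>) > 0" for \<theta>
    using pos[of \<theta>] z by linarith
  show c: "continuous_on A (\<lambda>\<theta>. norm (1 - z * cis \<theta>) powr (- 2 * p))" for A
    using pos' by (intro continuous_intros) (auto simp: less_imp_neq)
  have "(\<integral>\<theta>. norm (1 - z * cis \<theta>) powr (- 2 * p) \<partial>circle)
      \<le> (\<integral>\<theta>. (1 - norm z) powr (2 - 2 * p) * (1 / (norm (1 - z * cis \<theta>))\<^sup>2) \<partial>circle)"
  proof (intro integral_mono integrable_mult_right integrable_circle c poisson_kernel_circle z)
    fix \<theta>
    have "norm (1 - z * cis \<theta>) powr (- 2 * p) = 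
        norm (1 - z * cis \<theta>) powr (2 - 2 * p) * norm (1 - z * cis \<theta>) powr (-2)"
      by (simp add: powr_add [symmetric])
    also have "\<dots> \<le> (1 - norm z) powr (2 - 2 * p) * norm (1 - z * cis \<theta>) powr (-2)"
      using p z pos by (intro mult_right_mono powr_mono2') auto
    finally show "norm (1 - z * cis \<theta>) powr (- 2 * p)
       \<le> (1 - norm z) powr (2 - 2 * p) * (1 / (norm (1 - z * cis \<theta>))\<^sup>2)"
      using pos'[of \<theta>] by (simp add: powr_minus powr_numeral divide_inverse)
  qed
  also have "\<dots> = (1 - norm z) powr (2 - 2 * p) * (2 * pi / (1 - (norm z)\<^sup>2))"
    by (simp only: integral_mult_right_zero poisson_kernel_circle[OF z])
  also have "\<dots> \<le> (1 - norm z) powr (2 - 2 * p) * (2 * pi / (1 - norm z))"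
  proof -
    have "norm z * norm z \<le> norm z * 1" using z by (intro mult_left_mono) auto
    then show ?thesis using z by (intro mult_left_mono divide_left_mono) (auto simp: power2_eq_square)
  qed
  also have "\<dots> = 2 * pi * (1 - norm z) powr (1 - 2 * p)"
    using z powr_diff[of "1 - norm z" "2 - 2 * p" 1] by simp
  finally show "(\<integral>\<theta>. norm (1 - z * cis \<theta>) powr (- 2 * p) \<partial>circle) \<le> 2 * pi * (1 - norm z) powr (1 - 2 * p)" .
qed

lemma integral_mean_nonneg [simp]: "integral_mean p f r \<ge> 0"
  by (simp add: integral_mean_def)

text \<open>Poisson's formula for the dilation w -> f(R w), followed by Jensen with the Poisson
  kernel as weight. The kernel is at most (1 - |z|)^(-2) and its mass is 2 pi / (1 - |z|^2);
  together these give the factor (1 + |z|) / (1 - |z|), hence the constant 2.\<close>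

lemma norm_le_integral_mean:
  assumes f: "f holomorphic_on ball 0 1" and R: "0 < R" "R < 1" and z: "norm z < 1" and p: "p \<ge> 1"
  shows "norm (f (of_real R * z)) \<le> (2 / (1 - norm z)) powr (1 / p) * integral_mean p f R"
proof -
  define g where "g = (\<lambda>w. f (of_real R * w))"
  define P where "P = (\<lambda>\<theta>. 1 / (norm (1 - cnj z * cis \<theta>))\<^sup>2)"
  define D where "D = 1 - (norm z)\<^sup>2"
  have z': "norm (cnj z) < 1" using z by simp
  have D: "D > 0" using z by (simp add: D_def abs_square_less_1 power_less_one_iff)
  \<comment> \<open>The radius 1/R exceeds 1, as Poisson's formula requires.\<close>
  have "g holomorphic_on ball 0 (1 / R)"
    unfolding g_def
    by (rule holomorphic_on_compose_gen[OF _ f, unfolded o_def])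
       (use R in \<open>auto intro!: holomorphic_intros simp: norm_mult field_simps\<close>)
  from poisson_circle[OF this _ z] R
  have hi: "((\<lambda>\<theta>. P \<theta> *\<^sub>R g (cis \<theta>)) has_integral (2 * pi * g z / of_real D)) {0..2 * pi}"
    by (simp add: P_def D_def scaleR_conv_of_real mult.commute divide_inverse one_less_inverse)
  have cg: "continuous_on A (\<lambda>\<theta>. norm (g (cis \<theta>)) powr s)" if "s > 0" for A s
    unfolding g_def using R that
    by (intro continuous_on_circle_mean continuous_on_sphere_if_holomorphic[OF f]) auto
  have cg1: "continuous_on A (\<lambda>\<theta>. norm (g (cis \<theta>)))" for A
    using cg[of 1 A] by simp
  have cP: "continuous_on A P" for A
    unfolding P_def by (rule poisson_kernel_circle(1)[OF z'])
  have IP: "(\<integral>\<theta>. P \<theta> \<partial>circle) = 2 * pi / D"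
    unfolding P_def poisson_kernel_circle(2)[OF z'] by (simp add: D_def)
  have P0: "P \<theta> \<ge> 0" for \<theta> by (simp add: P_def)
  have P1: "P \<theta> \<le> 1 / (1 - norm z)\<^sup>2" for \<theta>
    using norm_kernel_ge[of "cis \<theta>" "cnj z"] z unfolding P_def
    by (intro divide_left_mono power_mono mult_pos_pos) auto
  have "norm (integral {0..2 * pi} (\<lambda>\<theta>. P \<theta> *\<^sub>R g (cis \<theta>))) \<le> integral {0..2 * pi} (\<lambda>\<theta>. P \<theta> * norm (g (cis \<theta>)))"
    by (intro integral_norm_bound_integral has_integral_integrable[OF hi]
        integrable_continuous_interval continuous_intros cP cg1)
       (auto simp: P0)
  then have "2 * pi / D * norm (g z) \<le> (\<integral>\<theta>. P \<theta> * norm (g (cis \<theta>)) \<partial>circle)"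
    using integral_unique[OF hi] D
    by (subst integral_circle) (auto intro!: continuous_intros cP cg1 simp: norm_mult norm_divide)
  then have "(2 * pi / D * norm (g z)) powr p \<le> (\<integral>\<theta>. P \<theta> * norm (g (cis \<theta>)) \<partial>circle) powr p"
    using p D by (intro powr_mono2) auto
  also have "\<dots> \<le> (\<integral>\<theta>. P \<theta> \<partial>circle) powr (p - 1) * (\<integral>\<theta>. P \<theta> * norm (g (cis \<theta>)) powr p \<partial>circle)"
    using p P0 by (intro weighted_jensen_powr integrable_circle continuous_intros cP cg1 cg) auto
  also have "\<dots> \<le> (2 * pi / D) powr (p - 1) * (\<integral>\<theta>. 1 / (1 - norm z)\<^sup>2 * norm (g (cis \<theta>)) powr p \<partial>circle)"
    unfolding IP using p P1
    by (intro mult_left_mono integral_mono integrable_circle continuous_intros cP cg1 cg mult_right_mono) auto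
  also have "\<dots> = (2 * pi / D) powr (p - 1) * (1 / (1 - norm z)\<^sup>2 * (2 * pi * integral_mean p f R powr p))"
    using integral_mean_powr[OF f, of R p] R p by (simp add: g_def)
  \<comment> \<open>The factor 2 pi of the mean completes the mass of the kernel to the power p,
    which then cancels against the left side.\<close>
  also have "\<dots> = (2 * pi / D) powr p * (D / (1 - norm z)\<^sup>2 * integral_mean p f R powr p)"
    using D by (simp add: powr_diff)
  finally have "(2 * pi / D) powr p * norm (g z) powr p
      \<le> (2 * pi / D) powr p * (D / (1 - norm z)\<^sup>2 * integral_mean p f R powr p)"
    using D by (simp add: powr_mult powr_divide)
  then have "norm (g z) powr p \<le> D / (1 - norm z)\<^sup>2 * integral_mean p f R powr p"
    by (rule mult_left_le_imp_le) (use D in auto)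
  also have "D / (1 - norm z)\<^sup>2 = (1 + norm z) / (1 - norm z)"
  proof -
    have "D = (1 + norm z) * (1 - norm z)"
      by (simp add: D_def power2_eq_square algebra_simps)
    then show ?thesis using z by (simp add: power2_eq_square)
  qed
  also have "\<dots> * integral_mean p f R powr p \<le> 2 / (1 - norm z) * integral_mean p f R powr p"
    using z by (intro mult_right_mono divide_right_mono) auto
  finally have "(norm (g z) powr p) powr (1 / p) \<le> (2 / (1 - norm z) * integral_mean p f R powr p) powr (1 / p)"
    using p by (intro powr_mono2) auto
  also have "\<dots> = (2 / (1 - norm z)) powr (1 / p) * integral_mean p f R"
    using p z by (subst powr_mult) (auto simp: powr_powr)
  finally show ?thesis
    using p by (simp add: powr_powr g_def)
qed

lemma integral_mean_le_hardy_norm: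
  assumes "f \<in> hardy_space p" "0 < r" "r < 1"
  shows "integral_mean p f r \<le> hardy_norm p f"
  using assms unfolding hardy_space_def hardy_norm_def by (auto intro!: cSUP_upper)

lemma hardy_norm_nonneg:
  assumes "f \<in> hardy_space p"
  shows "hardy_norm p f \<ge> 0"
  using integral_mean_le_hardy_norm[OF assms, of "1 / 2"] integral_mean_nonneg[of p f "1/2"] by linarith

lemma hardy_spaceD: "f \<in> hardy_space p \<Longrightarrow> f holomorphic_on ball 0 1"
  by (simp add: hardy_space_def)

lemma hardy_spaceI:
  assumes "f holomorphic_on ball 0 1" "\<And>r. 0 < r \<Longrightarrow> r < 1 \<Longrightarrow> integral_mean p f r \<le> B"
  shows "f \<in> hardy_space p" and "hardy_norm p f \<le> B"
  using assms unfolding hardy_space_def hardy_norm_def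
  by (auto intro!: cSUP_least bdd_aboveI2[where M=B])

text \<open>The estimate on the circle of radius R is applied at z / R, and R tends to 1 from the
  left.\<close>

lemma norm_le_hardy_norm:
  assumes f: "f \<in> hardy_space p" and p: "p \<ge> 1" and z: "norm z < 1"
  shows "norm (f z) \<le> (2 / (1 - norm z)) powr (1 / p) * hardy_norm p f"
proof (rule tendsto_lowerbound)
  show "((\<lambda>R. (2 / (1 - norm z / R)) powr (1 / p) * hardy_norm p f) \<longlongrightarrow>
      (2 / (1 - norm z)) powr (1 / p) * hardy_norm p f) (at_left 1)"
    using z by (auto intro!: tendsto_eq_intros)
  have "eventually (\<lambda>R. R \<in> {max (norm z) (1/2)<..<1}) (at_left 1)"
    using z by (intro eventually_at_left_real) auto
  then show "\<forall>\<^sub>F R in at_left 1. norm (f z) \<le> (2 / (1 - norm z / R)) powr (1 / p) * hardy_norm p f"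
  proof eventually_elim
    case (elim R)
    then have R: "0 < R" "R < 1" "norm z < R" by auto
    have "norm (f (of_real R * (z / of_real R))) \<le> (2 / (1 - norm (z / of_real R))) powr (1 / p) * integral_mean p f R"
      using R by (intro norm_le_integral_mean hardy_spaceD[OF f] p) (auto simp: norm_divide)
    also have "\<dots> \<le> (2 / (1 - norm (z / of_real R))) powr (1 / p) * hardy_norm p f"
      using R by (intro mult_left_mono integral_mean_le_hardy_norm f) auto
    finally show ?case using R by (simp add: norm_divide)
  qed
qed auto

lemma powr_add_le:
  fixes x y p :: real
  assumes "x \<ge> 0" "y \<ge> 0" "p \<ge> 0"
  shows "(x + y) powr p \<le> 2 powr p * (x powr p + y powr p)"
proof -
  have "(x + y) powr p \<le> (2 * max x y) powr p"
    using assms by (intro powr_mono2) auto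
  also have "\<dots> = 2 powr p * max x y powr p"
    using assms by (simp add: powr_mult)
  also have "\<dots> \<le> 2 powr p * (x powr p + y powr p)"
    by (intro mult_left_mono) (auto simp: max_def)
  finally show ?thesis .
qed

text \<open>Only membership is claimed, so the crude inequality \<open>powr_add_le\<close> can stand
  in for Minkowski's inequality.\<close>

lemma hardy_space_lincomb:
  assumes f: "f \<in> hardy_space p" and g: "g \<in> hardy_space p" and p: "p > 0"
  shows "(\<lambda>z. a * f z + b * g z) \<in> hardy_space p"
proof (rule hardy_spaceI)
  note hf = hardy_spaceD[OF f] and hg = hardy_spaceD[OF g]
  show hol: "(\<lambda>z. a * f z + b * g z) holomorphic_on ball 0 1"
    using hf hg by (intro holomorphic_intros)
  define C where "C = 2 powr p * (norm a powr p * hardy_norm p f powr p + norm b powr p * hardy_norm p g powr p)"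
  have C: "C \<ge> 0" by (simp add: C_def)
  fix r :: real assume r: "0 < r" "r < 1"
  have c: "continuous_on A (\<lambda>\<theta>. norm (h (of_real r * cis \<theta>)) powr p)" if "h holomorphic_on ball 0 1" for A h
    using r p that by (intro continuous_on_circle_mean continuous_on_sphere_if_holomorphic) auto
  have i: "(\<integral>\<theta>. norm (h (of_real r * cis \<theta>)) powr p \<partial>circle) \<le> 2 * pi * hardy_norm p h powr p"
    if "h \<in> hardy_space p" for h
  proof -
    have "integral_mean p h r powr p \<le> hardy_norm p h powr p"
      using that r p by (intro powr_mono2 integral_mean_le_hardy_norm) auto
    then show ?thesis
      using integral_mean_powr[OF hardy_spaceD[OF that], of r p] r p by (simp add: field_simps)
  qed
  show "integral_mean p (\<lambda>z. a * f z + b * g z) r \<le> C powr (1 / p)"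
  proof (rule integral_mean_leI[OF hol])
    let ?F = "\<lambda>h \<theta>. norm (h (of_real r * cis \<theta>)) powr p"
    have "(\<integral>\<theta>. norm (a * f (of_real r * cis \<theta>) + b * g (of_real r * cis \<theta>)) powr p \<partial>circle)
        \<le> (\<integral>\<theta>. 2 powr p * (norm a powr p * ?F f \<theta> + norm b powr p * ?F g \<theta>) \<partial>circle)"
    proof (intro integral_mono integrable_circle c[OF hol] c[OF hf] c[OF hg] continuous_on_mult continuous_on_const continuous_on_add)
      fix \<theta>
      let ?z = "of_real r * cis \<theta>"
      have "norm (a * f ?z + b * g ?z) powr p \<le> (norm (a * f ?z) + norm (b * g ?z)) powr p"
        using p by (intro powr_mono2 norm_triangle_ineq) auto
      also have "\<dots> \<le> 2 powr p * (norm (a * f ?z) powr p + norm (b * g ?z) powr p)"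
        using p by (intro powr_add_le) auto
      finally show "norm (a * f ?z + b * g ?z) powr p \<le> 2 powr p * (norm a powr p * ?F f \<theta> + norm b powr p * ?F g \<theta>)"
        by (simp add: norm_mult powr_mult)
    qed
    also have "\<dots> = 2 powr p * (norm a powr p * (\<integral>\<theta>. ?F f \<theta> \<partial>circle) + norm b powr p * (\<integral>\<theta>. ?F g \<theta> \<partial>circle))"
      by (simp add: integrable_circle c[OF hf] c[OF hg])
    also have "\<dots> \<le> 2 powr p * (norm a powr p * (2 * pi * hardy_norm p f powr p) + norm b powr p * (2 * pi * hardy_norm p g powr p))"
      by (intro mult_left_mono add_mono i f g) auto
    also have "\<dots> = 2 * pi * (C powr (1 / p)) powr p"
      using p C by (simp add: powr_powr) (simp add: C_def algebra_simps)
    finally show "(\<integral>\<theta>. norm (a * f (of_real r * cis \<theta>) + b * g (of_real r * cis \<theta>)) powr p \<partial>circle) \<le> \<dots>" .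
  qed (use r p in auto)
qed

subsection \<open>The integral representation\<close>

text \<open>Finiteness of the measure is supplied later by the Carleson condition at t = 0.\<close>

locale interval_measure = finite_measure \<mu> for \<mu> :: "real measure" +
  assumes sets_eq: "sets \<mu> = sets (restrict_space borel {0..<1})"
begin

lemma space_eq [simp]: "space \<mu> = {0..<1}"
  using sets_eq_imp_space_eq[OF sets_eq] by (simp add: space_restrict_space)

lemma borel_measurable_if_continuous:
  assumes "continuous_on {0..<1} f"
  shows "f \<in> borel_measurable \<mu>"
  using borel_measurable_continuous_on_restrict[OF assms] measurable_cong_sets[OF sets_eq refl] by blast

lemma borel_measurable_ident [measurable]: "(\<lambda>t. t) \<in> borel_measurable \<mu>"
  by (intro borel_measurable_if_continuous continuous_intros)

lemma tail_in_sets: "0 \<le> t \<Longrightarrow> {t..<1} \<in> sets \<mu>"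
  unfolding sets_eq sets_restrict_space by (rule image_eqI[of _ _ "{t..<1}"]) auto

lemma integrable_weight:
  assumes car: "carleson s \<mu>" and \<eta>: "0 \<le> \<eta>" "\<eta> < s"
  shows "integrable \<mu> (\<lambda>t. (1 - t) powr (- \<eta>))"
proof (rule integrableI_bounded)
  show "(\<lambda>t. (1 - t) powr (- \<eta>)) \<in> borel_measurable \<mu>" by measurable
  obtain C where C: "C > 0" "\<And>t. t \<in> {0..<1} \<Longrightarrow> emeasure \<mu> {t..<1} \<le> ennreal (C * (1 - t) powr s)"
    using car unfolding carleson_def by auto
  \<comment> \<open>Dyadic decomposition: the weight is comparable to \<open>2\<^bsup>j \<eta>\<^esup>\<close> where \<open>1 - t\<close> is comparable to \<open>2\<^bsup>-j\<^esup>\<close>.\<close>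
  define x :: "nat \<Rightarrow> real" where "x = (\<lambda>j. 1 - 2 powr - real j)"
  have x: "x j \<in> {0..<1}" for j
    using powr_mono[of "- real j" 0 "2::real"] by (auto simp: x_def)
  \<comment> \<open>\<open>c j\<close> is the value of the weight at 1 - t = 2^(-(j+1)), an upper
    bound on the block where 1 - t lies between 2^(-(j+1)) and 2^(-j).\<close>
  define c :: "nat \<Rightarrow> real" where "c = (\<lambda>j. 2 powr (\<eta> * (real j + 1)))"
  have pointwise: "ennreal (norm ((1 - t) powr (- \<eta>))) \<le> (\<Sum>j. ennreal (c j) * indicator {x j..<1} t)"
    if t: "t \<in> {0..<1}" for t
  proof -
    define j where "j = nat \<lfloor>- log 2 (1 - t)\<rfloor>"
    have "log 2 (1 - t) \<le> 0" using t by (subst log_le_zero_cancel_iff) auto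
    then have j: "real j \<le> - log 2 (1 - t)" "- log 2 (1 - t) < real j + 1"
      unfolding j_def by linarith+
    have "1 - t \<le> 2 powr - real j"
      using j(1) t by (subst log_le_iff[symmetric]) auto
    then have "x j \<le> t" by (simp add: x_def)
    have "2 powr (- (real j + 1)) < 1 - t"
      using j(2) t by (subst less_log_iff[symmetric]) auto
    then have "(1 - t) powr (- \<eta>) \<le> (2 powr (- (real j + 1))) powr (- \<eta>)"
      using \<eta> by (intro powr_mono2') auto
    also have "\<dots> = c j" by (simp add: powr_powr c_def algebra_simps)
    finally have "ennreal (norm ((1 - t) powr (- \<eta>))) \<le> ennreal (c j) * indicator {x j..<1} t"
      using \<open>x j \<le> t\<close> t by (simp add: ennreal_leI)
    also have "\<dots> \<le> (\<Sum>j. ennreal (c j) * indicator {x j..<1} t)"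
      proof -
      have "sum F {j} \<le> suminf F" for F :: "nat \<Rightarrow> ennreal"
        by (rule sum_le_suminf) auto
      then show ?thesis by simp
    qed
    finally show ?thesis .
  qed
  have "(\<integral>\<^sup>+t. ennreal (norm ((1 - t) powr (- \<eta>))) \<partial>\<mu>) \<le> (\<integral>\<^sup>+t. (\<Sum>j. ennreal (c j) * indicator {x j..<1} t) \<partial>\<mu>)"
    by (intro nn_integral_mono pointwise) simp
  also have "\<dots> = (\<Sum>j. \<integral>\<^sup>+t. ennreal (c j) * indicator {x j..<1} t \<partial>\<mu>)"
    using x tail_in_sets by (intro nn_integral_suminf borel_measurable_times borel_measurable_indicator) auto
  also have "\<dots> = (\<Sum>j. ennreal (c j) * emeasure \<mu> {x j..<1})"
    using x tail_in_sets by (intro suminf_cong nn_integral_cmult_indicator) auto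
  \<comment> \<open>The tail starting at \<open>x j\<close> has mass at most C 2^(-j s), so the
    series is dominated by a geometric one with ratio 2^(\<eta> - s) < 1.\<close>
  also have "\<dots> \<le> (\<Sum>j. ennreal (C * 2 powr \<eta> * (2 powr (\<eta> - s)) ^ j))"
  proof (intro suminf_le allI summableI)
    fix j
    have "ennreal (c j) * emeasure \<mu> {x j..<1} \<le> ennreal (c j) * ennreal (C * (1 - x j) powr s)"
      by (intro mult_left_mono C x) auto
    also have "\<dots> = ennreal (c j * (C * (1 - x j) powr s))"
      by (simp add: ennreal_mult c_def C(1) less_imp_le)
    also have "c j * (C * (1 - x j) powr s) = C * 2 powr \<eta> * (2 powr (\<eta> - s)) ^ j"
      by (simp add: c_def x_def powr_powr powr_realpow[symmetric] powr_add[symmetric] algebra_simps)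
    finally show "ennreal (c j) * emeasure \<mu> {x j..<1} \<le> ennreal (C * 2 powr \<eta> * (2 powr (\<eta> - s)) ^ j)" .
  qed
  also have "\<dots> < \<infinity>"
  proof -
    have "2 powr (\<eta> - s) < (2::real) powr 0" using \<eta> by (intro powr_less_mono) auto
    then have "summable (\<lambda>j. C * 2 powr \<eta> * (2 powr (\<eta> - s)) ^ j)"
      by (intro summable_mult summable_geometric) simp
    then show ?thesis using C(1) by (subst suminf_ennreal2) auto
  qed
  finally show "(\<integral>\<^sup>+t. ennreal (norm ((1 - t) powr (- \<eta>))) \<partial>\<mu>) < \<infinity>" .
qed

text \<open>The closed form of \<open>DH\<close>, as 1 / (1 - t z)^2 is the sum of (n+1) t^n z^n.
  The argument is a function on the interval alone, so that norm bounds apply to any measurable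
  function with the right growth, whether or not it comes from a Hardy space.\<close>

definition kernel_operator :: "(real \<Rightarrow> complex) \<Rightarrow> complex \<Rightarrow> complex" where
  "kernel_operator h z = (\<integral>t. h t / (1 - of_real t * z)\<^sup>2 \<partial>\<mu>)"

text \<open>The kernel is expanded in powers of z and integrated term by term; the n-th term is
  dominated by (n+1) |z|^n |h(t)|, summable in n and integrable in t.\<close>

lemma kernel_operator_sums:
  assumes h: "integrable \<mu> h" and z: "norm z < 1"
  shows "(\<lambda>n. of_nat (n + 1) * (\<integral>t. of_real (t ^ n) * h t \<partial>\<mu>) * z ^ n) sums kernel_operator h z"
proof -
  define F where "F = (\<lambda>n t. of_nat (n + 1) * (of_real (t ^ n) * h t) * z ^ n)"
  have int: "integrable \<mu> (\<lambda>t. of_real (t ^ n) * h t)" for n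
  proof (rule Bochner_Integration.integrable_bound[OF h])
    show "(\<lambda>t. of_real (t ^ n) * h t) \<in> borel_measurable \<mu>" using h by measurable
    show "AE t in \<mu>. norm (of_real (t ^ n) * h t) \<le> norm (h t)"
      by (auto intro!: AE_I2 mult_left_le_one_le simp: norm_mult norm_power power_le_one)
  qed
  have intF: "integrable \<mu> (F n)" for n
    unfolding F_def by (intro integrable_mult_left integrable_mult_right int)
  have normF: "norm (F n t) \<le> real (n + 1) * norm z ^ n * norm (h t)" if "t \<in> {0..<1}" for n t
  proof -
    have "norm (F n t) = real (n + 1) * norm z ^ n * (\<bar>t\<bar> ^ n * norm (h t))"
      unfolding F_def by (simp add: norm_mult norm_power del: of_nat_add of_nat_Suc)
    also have "\<dots> \<le> real (n + 1) * norm z ^ n * norm (h t)"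
      using that by (intro mult_left_mono mult_left_le_one_le) (auto simp: power_le_one)
    finally show ?thesis .
  qed
  have geo: "summable (\<lambda>n. real (n + 1) * norm z ^ n)"
    using geometric_deriv_sums[of "norm z"] z by (auto simp: sums_iff)
  have Fsum: "(\<lambda>n. F n t) sums (h t / (1 - of_real t * z)\<^sup>2)" if "t \<in> {0..<1}" for t
  proof -
    have "norm (of_real t * z) \<le> 1 * norm z"
      unfolding norm_mult using that by (intro mult_right_mono) auto
    then have "(\<lambda>n. of_nat (Suc n) * (of_real t * z) ^ n) sums (1 / (1 - of_real t * z)\<^sup>2)"
      using z by (intro geometric_deriv_sums) auto
    from sums_mult[OF this, of "h t"] show ?thesis
      by (simp add: F_def power_mult_distrib mult_ac)
  qed
  have "(\<lambda>n. integral\<^sup>L \<mu> (F n)) sums (\<integral>t. (\<Sum>n. F n t) \<partial>\<mu>)"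
  proof (rule sums_integral[OF intF])
    show "AE t in \<mu>. summable (\<lambda>n. norm (F n t))"
    proof (rule AE_I2)
      fix t assume "t \<in> space \<mu>"
      then show "summable (\<lambda>n. norm (F n t))"
        using normF by (intro summable_comparison_test'[OF summable_mult2[OF geo, of "norm (h t)"]]) auto
    qed
    show "summable (\<lambda>n. \<integral>t. norm (F n t) \<partial>\<mu>)"
    proof (rule summable_comparison_test'[OF summable_mult2[OF geo, of "\<integral>t. norm (h t) \<partial>\<mu>"]])
      fix n
      have "(\<integral>t. norm (F n t) \<partial>\<mu>) \<le> (\<integral>t. real (n + 1) * norm z ^ n * norm (h t) \<partial>\<mu>)"
        using normF by (intro integral_mono integrable_norm intF integrable_mult_right h) auto
      then show "norm (\<integral>t. norm (F n t) \<partial>\<mu>) \<le> real (n + 1) * norm z ^ n * (\<integral>t. norm (h t) \<partial>\<mu>)"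
        by simp
    qed
  qed
  also have "(\<integral>t. (\<Sum>n. F n t) \<partial>\<mu>) = kernel_operator h z"
    unfolding kernel_operator_def using Fsum by (intro Bochner_Integration.integral_cong) (auto simp: sums_iff)
  also have "(\<lambda>n. integral\<^sup>L \<mu> (F n)) = (\<lambda>n. of_nat (n + 1) * (\<integral>t. of_real (t ^ n) * h t \<partial>\<mu>) * z ^ n)"
    unfolding F_def by (simp only: integral_mult_left_zero integral_mult_right_zero)
  finally show ?thesis .
qed

lemma kernel_operator_holomorphic:
  assumes "integrable \<mu> h"
  shows "kernel_operator h holomorphic_on ball 0 1"
  using kernel_operator_sums[OF assms] by (intro power_series_holomorphic) auto

text \<open>The inner sum over k is exchanged with the integral, which needs an integrable majorant
  \<open>g\<close> of the absolute power series. Leaving \<open>g\<close> open allows two choices: a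
  multiple of (1 - t)^(-2) for general f in H^p under the stronger Carleson condition, and a
  constant for the test functions, where only a 1-Carleson measure is available.\<close>

lemma DH_eq_kernel_operator:
  assumes f: "f holomorphic_on ball 0 1" and g: "integrable \<mu> g"
    and le: "\<And>t. t \<in> {0..<1} \<Longrightarrow> (\<Sum>k. norm (taylor_coeff f k) * t ^ k) \<le> g t"
    and abs: "\<And>t. t \<in> {0..<1} \<Longrightarrow> summable (\<lambda>k. norm (taylor_coeff f k) * t ^ k)"
  shows "integrable \<mu> (\<lambda>t. f (of_real t))"
    and "norm z < 1 \<Longrightarrow> DH \<mu> f z = kernel_operator (\<lambda>t. f (of_real t)) z"
proof -
  let ?a = "taylor_coeff f"
  have fs: "(\<lambda>k. ?a k * of_real t ^ k) sums f (of_real t)" if "t \<in> {0..<1}" for t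
    using holomorphic_power_series[OF f, of "of_real t"] that by (simp add: taylor_coeff_def)
  have g0: "g t \<ge> 0" if "t \<in> {0..<1}" for t
    using le[OF that] suminf_nonneg[OF abs[OF that]] that by fastforce
  have fm: "(\<lambda>t. f (of_real t)) \<in> borel_measurable \<mu>"
    by (intro borel_measurable_if_continuous
          continuous_on_compose2[OF holomorphic_on_imp_continuous_on[OF f]] continuous_intros) auto
  show fi: "integrable \<mu> (\<lambda>t. f (of_real t))"
  proof (rule Bochner_Integration.integrable_bound[OF g fm], rule AE_I2)
    fix t assume "t \<in> space \<mu>"
    then have t: "t \<in> {0..<1}" by simp
    have "norm (f (of_real t)) = norm (\<Sum>k. ?a k * of_real t ^ k)"
      using fs[OF t] by (simp add: sums_iff)
    also have "\<dots> \<le> (\<Sum>k. norm (?a k * of_real t ^ k))"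
      using abs[OF t] t by (intro summable_norm) (simp add: norm_mult norm_power)
    also have "\<dots> \<le> g t"
      using le[OF t] t by (simp add: norm_mult norm_power)
    finally show "norm (f (of_real t)) \<le> norm (g t)" by simp
  qed
  have inner: "(\<lambda>k. of_real (moment \<mu> (n + k)) * ?a k) sums (\<integral>t. of_real (t ^ n) * f (of_real t) \<partial>\<mu>)" for n
  proof -
    define F where "F = (\<lambda>k t. of_real (t ^ (n + k)) * ?a k)"
    have int: "integrable \<mu> (\<lambda>t. t ^ m)" for m :: nat
      by (rule integrable_const_bound[where B = 1])
         (auto intro!: AE_I2 simp: power_le_one)
    have intF: "integrable \<mu> (F k)" for k
      unfolding F_def by (intro integrable_mult_left integrable_of_real int)
    have normF: "norm (F k t) \<le> norm (?a k) * t ^ k" if "t \<in> {0..<1}" for k t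
    proof -
      have "norm (F k t) = (t ^ n) * (norm (?a k) * t ^ k)"
        using that by (simp add: F_def norm_mult norm_power power_add)
      also have "\<dots> \<le> norm (?a k) * t ^ k"
        using that by (intro mult_left_le_one_le) (auto simp: power_le_one)
      finally show ?thesis .
    qed
    have "(\<lambda>k. integral\<^sup>L \<mu> (F k)) sums (\<integral>t. (\<Sum>k. F k t) \<partial>\<mu>)"
    proof (rule sums_integral[OF intF])
      show "AE t in \<mu>. summable (\<lambda>k. norm (F k t))"
      proof (rule AE_I2)
        fix t assume "t \<in> space \<mu>"
        then show "summable (\<lambda>k. norm (F k t))"
          using normF by (intro summable_comparison_test'[OF abs[of t]]) auto
      qed
      \<comment> \<open>The terms are nonnegative, and their partial sums stay below the integral of
        \<open>g\<close>.\<close>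
      show "summable (\<lambda>k. \<integral>t. norm (F k t) \<partial>\<mu>)"
      proof (rule bounded_imp_summable)
        fix m
        have "(\<Sum>k\<le>m. \<integral>t. norm (F k t) \<partial>\<mu>) = (\<integral>t. (\<Sum>k\<le>m. norm (F k t)) \<partial>\<mu>)"
          using intF by simp
        also have "\<dots> \<le> (\<integral>t. g t \<partial>\<mu>)"
        proof (intro integral_mono g Bochner_Integration.integrable_sum integrable_norm intF)
          fix t assume "t \<in> space \<mu>"
          then have t: "t \<in> {0..<1}" by simp
          have "(\<Sum>k\<le>m. norm (F k t)) \<le> (\<Sum>k\<le>m. norm (?a k) * t ^ k)"
            by (intro sum_mono normF t)
          also have "\<dots> \<le> (\<Sum>k. norm (?a k) * t ^ k)"
            using t by (intro sum_le_suminf abs) auto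
          finally show "(\<Sum>k\<le>m. norm (F k t)) \<le> g t" using le[OF t] by linarith
        qed
        finally show "(\<Sum>k\<le>m. \<integral>t. norm (F k t) \<partial>\<mu>) \<le> (\<integral>t. g t \<partial>\<mu>)" .
      qed simp
    qed
    also have "(\<integral>t. (\<Sum>k. F k t) \<partial>\<mu>) = (\<integral>t. of_real (t ^ n) * f (of_real t) \<partial>\<mu>)"
    proof (rule Bochner_Integration.integral_cong[OF refl])
      fix t assume "t \<in> space \<mu>"
      then have "(\<lambda>k. of_real (t ^ n) * (?a k * of_real t ^ k)) sums (of_real (t ^ n) * f (of_real t))"
        by (intro sums_mult fs) simp
      then show "(\<Sum>k. F k t) = of_real (t ^ n) * f (of_real t)"
        by (simp add: F_def sums_iff power_add mult_ac)
    qed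
    also have "(\<lambda>k. integral\<^sup>L \<mu> (F k)) = (\<lambda>k. of_real (moment \<mu> (n + k)) * ?a k)"
      unfolding F_def moment_def by (simp only: integral_mult_left_zero integral_complex_of_real)
    finally show ?thesis .
  qed
  show "DH \<mu> f z = kernel_operator (\<lambda>t. f (of_real t)) z" if "norm z < 1"
    using kernel_operator_sums[OF fi that] inner unfolding DH_def by (simp add: sums_iff del: of_real_power)
qed

end

section \<open>Minkowski's integral inequality for the kernel operator\<close>

lemma borel_measurable_circle_ident: "(\<lambda>\<theta>. \<theta>) \<in> borel_measurable circle"
  unfolding circle_def by (intro measurable_restrict_space1) simp

context interval_measure
begin

text \<open>The modulus of the integrand is written as v(t) k(\<theta>, t), where v is the weighted
  modulus of h and k is a normalised kernel whose q-th power has circle integral at most 2 pi for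
  each t. Jensen in t with weight v, then Fubini, bounds the circle integral of
  |\<open>kernel_operator h\<close>|^q by B^(q-1) times 2 pi B.\<close>

lemma kernel_operator_hardy:
  assumes q: "q \<ge> 1" and hm: "h \<in> borel_measurable \<mu>"
    and int: "integrable \<mu> (\<lambda>t. norm (h t) * (1 - t) powr (1 / q - 2))"
  shows "integrable \<mu> h"
    and "kernel_operator h \<in> hardy_space q"
    and "hardy_norm q (kernel_operator h) \<le> (\<integral>t. norm (h t) * (1 - t) powr (1 / q - 2) \<partial>\<mu>)"
proof -
  define v where "v = (\<lambda>t. norm (h t) * (1 - t) powr (1 / q - 2))"
  define B where "B = (\<integral>t. v t \<partial>\<mu>)"
  have q': "1 / q \<le> 1" using q by simp
  have v0: "v t \<ge> 0" for t by (simp add: v_def)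
  have B0: "B \<ge> 0" unfolding B_def by (intro integral_nonneg_AE AE_I2 v0)
  note intv = int[folded v_def]
  have h_le_v: "norm (h t) \<le> v t" if "t \<in> {0..<1}" for t
  proof -
    have "1 powr (1 / q - 2) \<le> (1 - t) powr (1 / q - 2)"
      using that q' by (intro powr_mono2') auto
    then have "norm (h t) * 1 \<le> v t" unfolding v_def by (intro mult_left_mono) auto
    then show ?thesis by simp
  qed
  show hi: "integrable \<mu> h"
    by (rule Bochner_Integration.integrable_bound[OF intv hm])
       (auto intro!: AE_I2 h_le_v order_trans[OF h_le_v abs_ge_self])
  have mean: "integral_mean q (kernel_operator h) r \<le> B" if r: "0 < r" "r < 1" for r
  proof -
    \<comment> \<open>The factor (1 - t)^(2 - 1/q) cancels the one in \<open>v\<close>; its q-th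
      power (1 - t)^(2q - 1) compensates the bound of \<open>kernel_power_mean\<close>.\<close>
    define k where "k = (\<lambda>\<theta> t. norm (1 - of_real t * (of_real r * cis \<theta>)) powr (-2) * (1 - t) powr (2 - 1 / q))"
    have den: "1 - t * r \<le> norm (1 - of_real t * (of_real r * cis \<theta>))" if "t \<in> {0..<1}" for t \<theta>
      using norm_kernel_ge[of "cis \<theta>" "of_real (t * r)"] that r by (simp add: norm_mult mult.assoc)
    have tr: "t * r \<le> r" "t * r \<le> t" if "t \<in> {0..<1}" for t
      using that r by (auto intro: mult_left_le_one_le mult_right_le_one_le)
    have k0: "k \<theta> t \<ge> 0" for \<theta> t by (simp add: k_def)
    have k1: "k \<theta> t \<le> (1 - r) powr (-2)" if t: "t \<in> {0..<1}" for \<theta> t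
    proof -
      have "1 - r \<le> norm (1 - of_real t * (of_real r * cis \<theta>))"
        using den[OF t, of \<theta>] tr(1)[OF t] by linarith
      then have "k \<theta> t \<le> (1 - r) powr (-2) * 1"
        unfolding k_def using r t q'
        by (intro mult_mono powr_mono2' powr_le1) auto
      then show ?thesis by simp
    qed
    \<comment> \<open>A bound on \<open>k\<close> that degenerates as r -> 1. It only secures
      integrability for Jensen and Fubini at fixed r and does not enter the final constant.\<close>
    define M where "M = (1 - r) powr (-2)"
    have M0: "M \<ge> 0" by (simp add: M_def)
    have kq: "k \<theta> t powr q \<le> M powr q" if t: "t \<in> {0..<1}" for \<theta> t
      using k1[OF t] k0 q unfolding M_def by (intro powr_mono2) auto
    have fst_meas: "(\<lambda>x. fst x) \<in> borel_measurable (circle \<Otimes>\<^sub>M \<mu>)"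
      by (rule measurable_compose[OF measurable_fst borel_measurable_circle_ident])
    have snd_meas: "(\<lambda>x. snd x) \<in> borel_measurable (circle \<Otimes>\<^sub>M \<mu>)"
      by (rule measurable_compose[OF measurable_snd borel_measurable_ident])
    have cis_meas: "cis \<in> borel_measurable borel"
      by (intro borel_measurable_continuous_onI continuous_intros)
    have km: "(\<lambda>x. k (fst x) (snd x)) \<in> borel_measurable (circle \<Otimes>\<^sub>M \<mu>)"
      unfolding k_def using measurable_compose[OF fst_meas cis_meas] snd_meas by measurable
    have vm: "v \<in> borel_measurable \<mu>" unfolding v_def using hm by measurable
    have km1: "(\<lambda>t. k \<theta> t) \<in> borel_measurable \<mu>" for \<theta> unfolding k_def by measurable
    have fm: "(\<lambda>x. v (snd x) * k (fst x) (snd x) powr q) \<in> borel_measurable (circle \<Otimes>\<^sub>M \<mu>)"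
      using measurable_compose[OF measurable_snd vm] km by measurable
    have intvk: "integrable \<mu> (\<lambda>t. v t * k \<theta> t)" for \<theta>
    proof (rule Bochner_Integration.integrable_bound[OF integrable_mult_left[OF intv, of M]])
      show "AE t in \<mu>. norm (v t * k \<theta> t) \<le> norm (v t * M)"
        using k0 k1 v0 M0 by (auto intro!: AE_I2 mult_left_mono simp: abs_mult M_def)
    qed (use vm km1 in measurable)
    have intvkq: "integrable \<mu> (\<lambda>t. v t * k \<theta> t powr q)" for \<theta>
    proof (rule Bochner_Integration.integrable_bound[OF integrable_mult_left[OF intv, of "M powr q"]])
      show "AE t in \<mu>. norm (v t * k \<theta> t powr q) \<le> norm (v t * M powr q)"
        using kq v0 by (auto intro!: AE_I2 mult_left_mono simp: abs_mult)
    qed (use vm km1 in measurable)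
    interpret circle: finite_measure circle by (rule finite_measure_circle)
    interpret P: pair_sigma_finite circle \<mu> ..
    have "(\<lambda>\<theta>. \<integral>t. v t * k \<theta> t powr q \<partial>\<mu>) \<in> borel_measurable circle"
      using fm by (intro borel_measurable_lebesgue_integral) (simp add: case_prod_unfold)
    then have int1: "integrable circle (\<lambda>\<theta>. \<integral>t. v t * k \<theta> t powr q \<partial>\<mu>)"
    proof (rule circle.integrable_const_bound[where B = "B * M powr q", rotated], intro AE_I2)
      fix \<theta>
      have "(\<integral>t. v t * k \<theta> t powr q \<partial>\<mu>) \<le> (\<integral>t. v t * M powr q \<partial>\<mu>)"
        using v0 kq by (intro integral_mono intvkq integrable_mult_left intv mult_left_mono) auto
      moreover have "(\<integral>t. v t * k \<theta> t powr q \<partial>\<mu>) \<ge> 0"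
        using v0 by (intro integral_nonneg_AE AE_I2) auto
      ultimately show "norm (\<integral>t. v t * k \<theta> t powr q \<partial>\<mu>) \<le> B * M powr q"
        by (simp add: B_def)
    qed
    have intP: "integrable (circle \<Otimes>\<^sub>M \<mu>) (\<lambda>(\<theta>, t). v t * k \<theta> t powr q)"
      using fm int1 intvkq v0
      by (intro P.Fubini_integrable) (auto simp: case_prod_unfold abs_mult)
    have inner: "integrable circle (\<lambda>\<theta>. v t * k \<theta> t powr q)"
        "(\<integral>\<theta>. v t * k \<theta> t powr q \<partial>circle) \<le> 2 * pi * v t" if t: "t \<in> {0..<1}" for t
    proof -
      let ?z = "of_real t * of_real r :: complex"
      have nz: "norm ?z = t * r" using t r by (simp add: norm_mult)
      have z: "norm ?z < 1" unfolding nz using tr[OF t] r by linarith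
      have eq: "v t * k \<theta> t powr q = v t * (1 - t) powr (2 * q - 1) * norm (1 - ?z * cis \<theta>) powr (- 2 * q)" for \<theta>
        using q by (simp add: k_def powr_mult powr_powr mult.assoc left_diff_distrib)
      show "integrable circle (\<lambda>\<theta>. v t * k \<theta> t powr q)"
        unfolding eq by (intro integrable_mult_right integrable_circle kernel_power_mean z q)
      have "(\<integral>\<theta>. v t * k \<theta> t powr q \<partial>circle) =
            v t * (1 - t) powr (2 * q - 1) * (\<integral>\<theta>. norm (1 - ?z * cis \<theta>) powr (- 2 * q) \<partial>circle)"
        unfolding eq by simp
      also have "\<dots> \<le> v t * (1 - t) powr (2 * q - 1) * (2 * pi * (1 - norm ?z) powr (1 - 2 * q))"
        using v0 by (intro mult_left_mono kernel_power_mean z q) auto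
      also have "\<dots> \<le> v t * (1 - t) powr (2 * q - 1) * (2 * pi * (1 - t) powr (1 - 2 * q))"
        unfolding nz using v0 t q tr[OF t] by (intro mult_left_mono powr_mono2') auto
      also have "\<dots> = 2 * pi * v t * ((1 - t) powr (2 * q - 1) * (1 - t) powr (1 - 2 * q))"
        by (simp only: mult_ac)
      also have "\<dots> = 2 * pi * v t"
        using t by (simp add: powr_add[symmetric])
      finally show "(\<integral>\<theta>. v t * k \<theta> t powr q \<partial>circle) \<le> 2 * pi * v t" .
    qed
    have point: "norm (kernel_operator h (of_real r * cis \<theta>)) powr q \<le> B powr (q - 1) * (\<integral>t. v t * k \<theta> t powr q \<partial>\<mu>)" for \<theta>
    proof -
      have "norm (kernel_operator h (of_real r * cis \<theta>)) \<le> (\<integral>t. norm (h t / (1 - of_real t * (of_real r * cis \<theta>))\<^sup>2) \<partial>\<mu>)"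
        unfolding kernel_operator_def by (rule integral_norm_bound)
      also have "\<dots> = (\<integral>t. v t * k \<theta> t \<partial>\<mu>)"
      proof (rule Bochner_Integration.integral_cong[OF refl])
        fix t assume "t \<in> space \<mu>"
        then have t: "t \<in> {0..<1}" by simp
        define D where "D = norm (1 - of_real t * (of_real r * cis \<theta>))"
        have "D > 0" using den[OF t, of \<theta>] tr[OF t] r unfolding D_def by linarith
        have "v t * k \<theta> t = norm (h t) * D powr (-2) * ((1 - t) powr (1 / q - 2) * (1 - t) powr (2 - 1 / q))"
          unfolding v_def k_def D_def by (simp only: mult_ac)
        also have "\<dots> = norm (h t) * D powr (-2)"
          using t by (simp add: powr_add[symmetric])
        also have "\<dots> = norm (h t / (1 - of_real t * (of_real r * cis \<theta>))\<^sup>2)"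
        proof -
          have "norm (h t / (1 - of_real t * (of_real r * cis \<theta>))\<^sup>2) = norm (h t) / D\<^sup>2"
            unfolding D_def by (simp only: norm_divide norm_power)
          then show ?thesis using \<open>D > 0\<close> by (simp add: powr_minus powr_numeral divide_inverse)
        qed
        finally show "norm (h t / (1 - of_real t * (of_real r * cis \<theta>))\<^sup>2) = v t * k \<theta> t" ..
      qed
      finally have "norm (kernel_operator h (of_real r * cis \<theta>)) powr q \<le> (\<integral>t. v t * k \<theta> t \<partial>\<mu>) powr q"
        using q by (intro powr_mono2) auto
      also have "\<dots> \<le> B powr (q - 1) * (\<integral>t. v t * k \<theta> t powr q \<partial>\<mu>)"
        unfolding B_def by (intro weighted_jensen_powr q v0 k0 intv intvk intvkq)
      finally show ?thesis .
    qed
    show ?thesis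
    proof (rule integral_mean_leI[OF kernel_operator_holomorphic[OF hi]])
      have "(\<integral>\<theta>. norm (kernel_operator h (of_real r * cis \<theta>)) powr q \<partial>circle)
          \<le> (\<integral>\<theta>. B powr (q - 1) * (\<integral>t. v t * k \<theta> t powr q \<partial>\<mu>) \<partial>circle)"
        using r q by (intro integral_mono integrable_circle continuous_on_circle_mean point
            continuous_on_sphere_if_holomorphic[OF kernel_operator_holomorphic[OF hi]] integrable_mult_right int1) auto
      also have "\<dots> = B powr (q - 1) * (\<integral>\<theta>. (\<integral>t. v t * k \<theta> t powr q \<partial>\<mu>) \<partial>circle)"
        by simp
      also have "(\<integral>\<theta>. (\<integral>t. v t * k \<theta> t powr q \<partial>\<mu>) \<partial>circle) = (\<integral>t. (\<integral>\<theta>. v t * k \<theta> t powr q \<partial>circle) \<partial>\<mu>)"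
        by (rule P.Fubini_integral[OF intP, symmetric])
      also have "\<dots> \<le> (\<integral>t. 2 * pi * v t \<partial>\<mu>)"
        using P.integrable_snd[OF intP] inner by (intro integral_mono integrable_mult_right intv) auto
      also have "\<dots> = 2 * pi * B" by (simp add: B_def)
      finally have "(\<integral>\<theta>. norm (kernel_operator h (of_real r * cis \<theta>)) powr q \<partial>circle) \<le> B powr (q - 1) * (2 * pi * B)"
        by (simp add: mult_left_mono)
      also have "\<dots> = 2 * pi * B powr q"
        using B0 by (cases "B = 0") (simp_all add: powr_diff)
      finally show "(\<integral>\<theta>. norm (kernel_operator h (of_real r * cis \<theta>)) powr q \<partial>circle) \<le> 2 * pi * B powr q" .
    qed (use r q B0 in auto)
  qed
  show "kernel_operator h \<in> hardy_space q"
    using mean by (rule hardy_spaceI[OF kernel_operator_holomorphic[OF hi]])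
  show "hardy_norm q (kernel_operator h) \<le> (\<integral>t. norm (h t) * (1 - t) powr (1 / q - 2) \<partial>\<mu>)"
    using hardy_spaceI(2)[OF kernel_operator_holomorphic[OF hi] mean] by (simp add: B_def v_def)
qed

end

subsection \<open>Sufficiency\<close>

text \<open>\<open>DH\<close> and \<open>kernel_operator\<close> are known to agree only inside the
  disc; this transfers membership and norms between them.\<close>

lemma hardy_cong:
  assumes "\<And>z. z \<in> ball 0 1 \<Longrightarrow> f z = g z"
  shows "f \<in> hardy_space p \<longleftrightarrow> g \<in> hardy_space p" and "hardy_norm p f = hardy_norm p g"
proof -
  have "integral_mean p f r = integral_mean p g r" if "r \<in> {0<..<1}" for r
    unfolding integral_mean_def using that by (simp add: assms norm_mult)
  then have "integral_mean p f ` {0<..<1} = integral_mean p g ` {0<..<1}"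
    by (intro image_cong) auto
  moreover have "f holomorphic_on ball 0 1 \<longleftrightarrow> g holomorphic_on ball 0 1"
    by (rule holomorphic_cong) (auto simp: assms)
  ultimately show "f \<in> hardy_space p \<longleftrightarrow> g \<in> hardy_space p" and "hardy_norm p f = hardy_norm p g"
    by (simp_all add: hardy_space_def hardy_norm_def)
qed

lemma taylor_coeff_abs_sum:
  assumes f: "f holomorphic_on ball 0 1" and N: "N \<ge> 0"
    and le: "\<And>z. norm z < 1 \<Longrightarrow> norm (f z) \<le> N / (1 - norm z)"
    and t: "0 \<le> t" "t < 1"
  shows "summable (\<lambda>k. norm (taylor_coeff f k) * t ^ k)"
    and "(\<Sum>k. norm (taylor_coeff f k) * t ^ k) \<le> 4 * N * (1 - t) powr (-2)"
proof -
  \<comment> \<open>Cauchy's estimates on the circle half-way between \<open>t\<close> and the boundary.\<close>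
  define r where "r = (1 + t) / 2"
  have r: "0 < r" "r < 1" "t < r" using t by (auto simp: r_def)
  have coeff: "norm (taylor_coeff f k) * t ^ k \<le> N / (1 - r) * (t / r) ^ k" for k
  proof -
    have "norm ((deriv ^^ k) f 0) \<le> fact k * (N / (1 - r)) / r ^ k"
    proof (rule Cauchy_inequality)
      show "f holomorphic_on ball 0 r" "continuous_on (cball 0 r) f"
        using r by (auto intro!: holomorphic_on_subset[OF f]
            continuous_on_subset[OF holomorphic_on_imp_continuous_on[OF f]])
      show "norm (f x) \<le> N / (1 - r)" if "norm (0 - x) = r" for x
        using le[of x] that r by simp
    qed (rule r)
    then have "norm (taylor_coeff f k) \<le> N / (1 - r) / r ^ k"
      by (simp add: taylor_coeff_def norm_divide divide_le_eq mult.commute)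
    then have "norm (taylor_coeff f k) * t ^ k \<le> N / (1 - r) / r ^ k * t ^ k"
      using t by (intro mult_right_mono) auto
    then show ?thesis by (simp add: power_divide)
  qed
  have tr: "norm (t / r) < 1" using t r by simp
  have geo: "(\<lambda>k. N / (1 - r) * (t / r) ^ k) sums (N / (1 - r) * (1 / (1 - t / r)))"
    by (intro sums_mult geometric_sums tr)
  show sm: "summable (\<lambda>k. norm (taylor_coeff f k) * t ^ k)"
    using coeff t by (intro summable_comparison_test'[OF sums_summable[OF geo]]) auto
  have "(\<Sum>k. norm (taylor_coeff f k) * t ^ k) \<le> N / (1 - r) * (1 / (1 - t / r))"
    using suminf_le[OF coeff sm sums_summable[OF geo]] geo by (simp add: sums_iff)
  also have "\<dots> \<le> N / (1 - r) * (1 / (1 - r))"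
  proof -
    have "1 - r \<le> 1 - t / r"
    proof -
      \<comment> \<open>The arithmetic-geometric mean inequality for 1 and t.\<close>
      have "t \<le> r * r" 
        using zero_le_power2[of "1 - t"] by (simp add: r_def power2_eq_square field_simps)
      then show ?thesis using r by (simp add: field_simps)
    qed
    then show ?thesis using r N by (intro mult_left_mono divide_left_mono mult_pos_pos) auto
  qed
  also have "\<dots> = 4 * N * (1 - t) powr (-2)"
  proof -
    \<comment> \<open>Each of the two factors 1 / (1 - r) contributes a 2, which explains the
      constant 4.\<close>
    have r2: "1 - r = (1 - t) / 2" by (simp add: r_def field_simps)
    have "(1 - t) powr (-2) = 1 / ((1 - t) * (1 - t))"
      using t by (simp add: powr_minus powr_numeral power2_eq_square divide_inverse)
    then show ?thesis unfolding r2 by simp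
  qed
  finally show "(\<Sum>k. norm (taylor_coeff f k) * t ^ k) \<le> 4 * N * (1 - t) powr (-2)" .
qed

text \<open>The exponent 1/p is weakened to 1 to match the hypothesis of
  \<open>taylor_coeff_abs_sum\<close>. The loss is harmless, because it is used only where (1 -
  t)^(-2) is integrable.\<close>

lemma hardy_growth:
  assumes f: "f \<in> hardy_space p" and p: "p \<ge> 1" and z: "norm z < 1"
  shows "norm (f z) \<le> 2 * hardy_norm p f / (1 - norm z)"
proof -
  have "(2 / (1 - norm z)) powr (1 / p) \<le> (2 / (1 - norm z)) powr 1"
    using p z by (intro powr_mono) (auto simp: field_simps)
  also have "\<dots> = 2 / (1 - norm z)" using z by simp
  finally have "(2 / (1 - norm z)) powr (1 / p) * hardy_norm p f \<le> 2 / (1 - norm z) * hardy_norm p f"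
    by (intro mult_right_mono hardy_norm_nonneg[OF f])
  then show ?thesis using norm_le_hardy_norm[OF f p z] by simp
qed

text \<open>The Taylor series converges at (1 + R) / 2 > 1, hence absolutely at 1.\<close>

lemma taylor_coeff_abs_summable:
  assumes "f holomorphic_on ball 0 R" "R > 1"
  shows "summable (\<lambda>k. norm (taylor_coeff f k))"
proof -
  let ?w = "of_real ((1 + R) / 2) :: complex"
  have w: "norm ?w = (1 + R) / 2" using assms(2) by (simp only: norm_of_real) simp
  have "(\<lambda>k. taylor_coeff f k * (?w - 0) ^ k) sums f ?w"
    unfolding taylor_coeff_def using assms w by (intro holomorphic_power_series[OF assms(1)]) auto
  then have "summable (\<lambda>k. taylor_coeff f k * ?w ^ k)" by (simp add: sums_iff)
  from powser_insidea[OF this, of 1] show ?thesis using w assms(2) by simp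
qed

context interval_measure
begin

lemma kernel_integrable:
  assumes h: "integrable \<mu> h" and z: "norm z < 1"
  shows "integrable \<mu> (\<lambda>t. h t / (1 - of_real t * z)\<^sup>2)"
    and "norm (kernel_operator h z) \<le> (\<integral>t. norm (h t) \<partial>\<mu>) / (1 - norm z)\<^sup>2"
proof -
  have le: "norm (h t / (1 - of_real t * z)\<^sup>2) \<le> norm (h t) / (1 - norm z)\<^sup>2" if t: "t \<in> {0..<1}" for t
  proof -
    have "1 - norm z \<le> norm (1 - of_real t * z)"
      using norm_kernel_ge[of "of_real t" z] t by (simp add: mult.commute)
    then show ?thesis
      using z unfolding norm_divide norm_power
      by (intro divide_left_mono power_mono mult_pos_pos zero_less_power) auto
  qed
  show i: "integrable \<mu> (\<lambda>t. h t / (1 - of_real t * z)\<^sup>2)"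
  proof (rule Bochner_Integration.integrable_bound[OF integrable_divide[OF integrable_norm[OF h], of "(1 - norm z)\<^sup>2"]])
    show "(\<lambda>t. h t / (1 - of_real t * z)\<^sup>2) \<in> borel_measurable \<mu>" using h by measurable
  qed (use le in \<open>auto intro!: AE_I2\<close>)
  have "norm (kernel_operator h z) \<le> (\<integral>t. norm (h t / (1 - of_real t * z)\<^sup>2) \<partial>\<mu>)"
    unfolding kernel_operator_def by (rule integral_norm_bound)
  also have "\<dots> \<le> (\<integral>t. norm (h t) / (1 - norm z)\<^sup>2 \<partial>\<mu>)"
    using le by (intro integral_mono integrable_norm i integrable_divide h) auto
  finally show "norm (kernel_operator h z) \<le> (\<integral>t. norm (h t) \<partial>\<mu>) / (1 - norm z)\<^sup>2" by simp
qed

lemma kernel_operator_lincomb: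
  assumes "integrable \<mu> h" "integrable \<mu> k" "norm z < 1"
  shows "kernel_operator (\<lambda>t. a * h t + b * k t) z = a * kernel_operator h z + b * kernel_operator k z"
proof -
  have "kernel_operator (\<lambda>t. a * h t + b * k t) z = 
    (\<integral>t. a * (h t / (1 - of_real t * z)\<^sup>2) + b * (k t / (1 - of_real t * z)\<^sup>2) \<partial>\<mu>)"
    unfolding kernel_operator_def by (simp add: add_divide_distrib)
  also have "\<dots> = a * kernel_operator h z + b * kernel_operator k z"
    unfolding kernel_operator_def
    using kernel_integrable(1)[OF assms(1,3)] kernel_integrable(1)[OF assms(2,3)]
    by (simp only: Bochner_Integration.integral_add integrable_mult_right integral_mult_right_zero)
  finally show ?thesis .
qed

text \<open>The growth of f contributes the exponent -1/p and the norm of the kernel contributes 1/q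
  - 2, in total -\<sigma>. Since \<gamma> > 0 puts \<sigma> strictly below the Carleson exponent, (1
  - t)^(-\<sigma>) is integrable; this one weight yields both boundedness and the majorant for
  dominated convergence.\<close>

lemma DH_compact_if_carleson:
  assumes p: "1 < p" "p \<le> q" and \<gamma>: "\<gamma> > 0"
    and car: "carleson (1 / p + 2 - 1 / q + \<gamma>) \<mu>"
  shows "compact_operator_hardy p q (DH \<mu>)"
proof -
  define \<sigma> where "\<sigma> = 1 / p + 2 - 1 / q"
  have "1 / q \<le> 1 / p" using p by (intro divide_left_mono) auto
  \<comment> \<open>This is where p <= q enters: it makes (1 - t)^(-2) integrable, as the majorant
    of the Taylor series demands.\<close>
  then have \<sigma>: "\<sigma> \<ge> 2" by (simp add: \<sigma>_def)
  have w: "integrable \<mu> (\<lambda>t. (1 - t) powr (- \<eta>))" if "0 \<le> \<eta>" "\<eta> \<le> \<sigma>" for \<eta>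
    using that \<gamma> by (intro integrable_weight[OF car]) (auto simp: \<sigma>_def)
  have p1: "p \<ge> 1" and q1: "q \<ge> 1" using p by auto
  have rep: "integrable \<mu> (\<lambda>t. f (of_real t))"
      "\<And>z. norm z < 1 \<Longrightarrow> DH \<mu> f z = kernel_operator (\<lambda>t. f (of_real t)) z" if f: "f \<in> hardy_space p" for f
  proof -
    have N: "2 * hardy_norm p f \<ge> 0" using hardy_norm_nonneg[OF f] by simp
    note c = taylor_coeff_abs_sum[OF hardy_spaceD[OF f] N hardy_growth[OF f p1]]
    have g: "integrable \<mu> (\<lambda>t. 4 * (2 * hardy_norm p f) * (1 - t) powr (-2))"
      using \<sigma> by (intro integrable_mult_right w) auto
    show "integrable \<mu> (\<lambda>t. f (of_real t))"
      by (rule DH_eq_kernel_operator(1)[OF hardy_spaceD[OF f] g]) (use c in auto)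
    show "DH \<mu> f z = kernel_operator (\<lambda>t. f (of_real t)) z" if "norm z < 1" for z
      by (rule DH_eq_kernel_operator(2)[OF hardy_spaceD[OF f] g _ _ that]) (use c in auto)
  qed
  have weight_le: "x * (1 - t) powr (1 / q - 2) \<le> 2 powr (1 / p) * N * (1 - t) powr (- \<sigma>)"
    if "t \<in> {0..<1}" "x \<le> (2 / (1 - t)) powr (1 / p) * N" for x t N
  proof -
    have inv: "(2 / (1 - t)) powr (1 / p) = 2 powr (1 / p) * (1 - t) powr (- (1 / p))"
      using that by (simp add: powr_divide powr_minus_divide)
    have "x * (1 - t) powr (1 / q - 2) \<le> (2 / (1 - t)) powr (1 / p) * N * (1 - t) powr (1 / q - 2)"
      using that by (intro mult_right_mono) auto
    also have "\<dots> = 2 powr (1 / p) * N * ((1 - t) powr (- (1 / p)) * (1 - t) powr (1 / q - 2))"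
      unfolding inv by (simp only: mult_ac)
    also have "(1 - t) powr (- (1 / p)) * (1 - t) powr (1 / q - 2) = (1 - t) powr (- \<sigma>)"
      unfolding powr_add[symmetric] \<sigma>_def by (simp add: algebra_simps)
    finally show ?thesis .
  qed
  \<comment> \<open>Stated for any measurable function with the growth of an H^p function, so that
    it also covers the locally uniform limit and the differences below.\<close>
  have weighted: "integrable \<mu> (\<lambda>t. norm (h t) * (1 - t) powr (1 / q - 2))"
    if hm: "h \<in> borel_measurable \<mu>" and hb: "\<And>t. t \<in> {0..<1} \<Longrightarrow> norm (h t) \<le> (2 / (1 - t)) powr (1 / p) * N" for h :: "real \<Rightarrow> complex" and N
  proof (rule Bochner_Integration.integrable_bound)
    show "integrable \<mu> (\<lambda>t. 2 powr (1 / p) * N * (1 - t) powr (- \<sigma>))"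
      using \<sigma> by (intro integrable_mult_right w) auto
    show "AE t in \<mu>. norm (norm (h t) * (1 - t) powr (1 / q - 2)) \<le> norm (2 powr (1 / p) * N * (1 - t) powr (- \<sigma>))"
    proof (rule AE_I2)
      fix t assume "t \<in> space \<mu>"
      then have "norm (h t) * (1 - t) powr (1 / q - 2) \<le> 2 powr (1 / p) * N * (1 - t) powr (- \<sigma>)"
        by (intro weight_le hb) auto
      then show "norm (norm (h t) * (1 - t) powr (1 / q - 2)) \<le> norm (2 powr (1 / p) * N * (1 - t) powr (- \<sigma>))"
        by simp
    qed
  qed (use hm in measurable)
  have eval: "norm (f (of_real t)) \<le> (2 / (1 - t)) powr (1 / p) * hardy_norm p f"
    if "f \<in> hardy_space p" "t \<in> {0..<1}" for f and t :: real
    using norm_le_hardy_norm[OF that(1) p1, of "of_real t"] that(2) by simp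
  have maps: "DH \<mu> f \<in> hardy_space q" if f: "f \<in> hardy_space p" for f
  proof -
    have "kernel_operator (\<lambda>t. f (of_real t)) \<in> hardy_space q"
      using rep(1)[OF f] by (intro kernel_operator_hardy(2)[OF q1] weighted[OF _ eval[OF f]]) auto
    then show ?thesis using rep(2)[OF f] by (subst hardy_cong(1)) auto
  qed
  have lin: "DH \<mu> (\<lambda>w. a * f w + b * g w) z = a * DH \<mu> f z + b * DH \<mu> g z"
    if f: "f \<in> hardy_space p" and g: "g \<in> hardy_space p" and z: "norm z < 1" for f g a b z
    using rep(2)[OF hardy_space_lincomb[OF f g, of a b] z] rep(2)[OF f z] rep(2)[OF g z]
      kernel_operator_lincomb[OF rep(1)[OF f] rep(1)[OF g] z, of a b] p by simp
  have comp: "\<exists>r g. strict_mono r \<and> g \<in> hardy_space q \<and>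
           (\<lambda>n. hardy_norm q (\<lambda>z. DH \<mu> (F (r n)) z - g z)) \<longlonglongrightarrow> 0"
    if F: "\<And>n. F n \<in> hardy_space p" and M: "\<And>n. hardy_norm p (F n) \<le> M" for F :: "nat \<Rightarrow> complex \<Rightarrow> complex" and M
  proof -
    have M0: "M \<ge> 0" using hardy_norm_nonneg[OF F] M by (rule order_trans)
    have bound: "norm (F n z) \<le> (2 / (1 - norm z)) powr (1 / p) * M" if "norm z < 1" for n z
      using norm_le_hardy_norm[OF F p1 that, of n] mult_left_mono[OF M[of n], of "(2 / (1 - norm z)) powr (1 / p)"] by simp
    \<comment> \<open>The growth estimate bounds the sequence uniformly on compact sets, so Montel's
      theorem gives a subsequence converging at every point of the disc.\<close>
    obtain g r where g: "g holomorphic_on ball 0 1" and r: "strict_mono (r :: nat \<Rightarrow> nat)"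
      and lim: "\<And>z. z \<in> ball 0 1 \<Longrightarrow> (\<lambda>n. F (r n) z) \<longlonglongrightarrow> g z"
    proof (rule Montel[of "ball 0 1" "range F" F])
      show "\<exists>B. \<forall>h\<in>range F. \<forall>z\<in>K. norm (h z) \<le> B" if K: "compact K" "K \<subseteq> ball 0 1" for K
      proof -
        have "continuous_on K (\<lambda>z::complex. (2 / (1 - norm z)) powr (1 / p) * M)"
          using K(2) by (intro continuous_intros) auto
        then have "bounded ((\<lambda>z. (2 / (1 - norm z)) powr (1 / p) * M) ` K)"
          by (intro compact_imp_bounded compact_continuous_image K(1))
        then obtain B where B: "\<And>z. z \<in> K \<Longrightarrow> norm ((2 / (1 - norm z)) powr (1 / p) * M) \<le> B"
          unfolding bounded_iff by auto
        have "norm (F n z) \<le> B" if "z \<in> K" for n z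
          using bound[of z n] B[OF that] K(2) that by force
        then show ?thesis by auto
      qed
    qed (use hardy_spaceD[OF F] in auto)
    let ?g = "\<lambda>t. g (of_real t)" and ?f = "\<lambda>n t. F (r n) (of_real t)"
    let ?d = "\<lambda>n t. ?f n t - ?g t"
    have gm: "?g \<in> borel_measurable \<mu>"
      by (intro borel_measurable_if_continuous
            continuous_on_compose2[OF holomorphic_on_imp_continuous_on[OF g]] continuous_intros) auto
    have fi: "integrable \<mu> (?f n)" for n by (rule rep(1)[OF F])
    have fb: "norm (?f n t) \<le> (2 / (1 - t)) powr (1 / p) * M" if "t \<in> {0..<1}" for n t
      using bound[of "of_real t"] that by simp
    \<comment> \<open>The growth bound passes to the pointwise limit, which makes
      \<open>weighted\<close> applicable to it.\<close>
    have gb: "norm (?g t) \<le> (2 / (1 - t)) powr (1 / p) * M" if t: "t \<in> {0..<1}" for t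
    proof (rule LIMSEQ_le_const2)
      show "(\<lambda>n. norm (?f n t)) \<longlonglongrightarrow> norm (?g t)"
        using t by (intro tendsto_norm lim) auto
    qed (use fb[OF t] in auto)
    have db: "norm (?d n t) \<le> (2 / (1 - t)) powr (1 / p) * (2 * M)" if t: "t \<in> {0..<1}" for n t
      using norm_triangle_ineq4[of "?f n t" "?g t"] fb[OF t, of n] gb[OF t] by simp
    have dm: "?d n \<in> borel_measurable \<mu>" for n
      using borel_measurable_integrable[OF fi] gm by measurable
    note gw = weighted[OF gm gb] and dw = weighted[OF dm db]
    have gi: "integrable \<mu> ?g" by (rule kernel_operator_hardy(1)[OF q1 gm gw])
    have "(\<lambda>n. \<integral>t. norm (?d n t) * (1 - t) powr (1 / q - 2) \<partial>\<mu>) \<longlonglongrightarrow> (\<integral>t. 0 \<partial>\<mu>)"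
    proof (rule integral_dominated_convergence)
      show "integrable \<mu> (\<lambda>t. 2 powr (1 / p) * (2 * M) * (1 - t) powr (- \<sigma>))"
        using \<sigma> by (intro integrable_mult_right w) auto
      show "AE t in \<mu>. (\<lambda>n. norm (?d n t) * (1 - t) powr (1 / q - 2)) \<longlonglongrightarrow> 0"
      proof (rule AE_I2)
        fix t assume "t \<in> space \<mu>"
        then have "(\<lambda>n. ?d n t) \<longlonglongrightarrow> ?g t - ?g t"
          by (intro tendsto_diff lim tendsto_const) auto
        then show "(\<lambda>n. norm (?d n t) * (1 - t) powr (1 / q - 2)) \<longlonglongrightarrow> 0"
          by (intro tendsto_mult_left_zero tendsto_norm_zero) simp
      qed
      show "AE t in \<mu>. norm (norm (?d n t) * (1 - t) powr (1 / q - 2)) \<le> 2 powr (1 / p) * (2 * M) * (1 - t) powr (- \<sigma>)" for n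
      proof (rule AE_I2)
        fix t assume "t \<in> space \<mu>"
        then have "norm (?d n t) * (1 - t) powr (1 / q - 2) \<le> 2 powr (1 / p) * (2 * M) * (1 - t) powr (- \<sigma>)"
          by (intro weight_le db) auto
        then show "norm (norm (?d n t) * (1 - t) powr (1 / q - 2)) \<le> 2 powr (1 / p) * (2 * M) * (1 - t) powr (- \<sigma>)"
          by simp
      qed
    qed (use dw borel_measurable_integrable in auto)
    then have lim0: "(\<lambda>n. \<integral>t. norm (?d n t) * (1 - t) powr (1 / q - 2) \<partial>\<mu>) \<longlonglongrightarrow> 0" by simp
    \<comment> \<open>The limit in H^q is \<open>kernel_operator ?g\<close>; the norm bound then
      reduces convergence to the integrals of the weighted differences, which tend to 0.\<close>
    have diff: "DH \<mu> (F (r n)) z - kernel_operator ?g z = kernel_operator (?d n) z" if "norm z < 1" for n z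
      using kernel_operator_lincomb[OF fi gi that, of 1 n "-1"] rep(2)[OF F that] by simp
    have eq: "hardy_norm q (\<lambda>z. DH \<mu> (F (r n)) z - kernel_operator ?g z) = hardy_norm q (kernel_operator (?d n))" for n
      by (rule hardy_cong(2)) (use diff in auto)
    have "(\<lambda>n. hardy_norm q (\<lambda>z. DH \<mu> (F (r n)) z - kernel_operator ?g z)) \<longlonglongrightarrow> 0"
      unfolding eq using hardy_norm_nonneg[OF kernel_operator_hardy(2)[OF q1 dm dw]]
        kernel_operator_hardy(3)[OF q1 dm dw]
      by (intro tendsto_sandwich[OF _ _ tendsto_const lim0]) auto
    then show ?thesis using r kernel_operator_hardy(2)[OF q1 gm gw] by blast
  qed
  show ?thesis
    unfolding compact_operator_hardy_def
  proof (intro conjI allI ballI impI)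
    fix F :: "nat \<Rightarrow> complex \<Rightarrow> complex"
    assume "(\<forall>n. F n \<in> hardy_space p) \<and> (\<exists>M. \<forall>n. hardy_norm p (F n) \<le> M)"
    then obtain M where "\<And>n. F n \<in> hardy_space p" "\<And>n. hardy_norm p (F n) \<le> M" by blast
    then show "\<exists>r g. strict_mono r \<and> g \<in> hardy_space q \<and>
           (\<lambda>n. hardy_norm q (\<lambda>z. DH \<mu> (F (r n)) z - g z)) \<longlonglongrightarrow> 0"
      by (rule comp)
  qed (use maps lin in auto)
qed

end

subsection \<open>Necessity\<close>

text \<open>The kernel of the operator itself, with the parameter a in place of t. By
  \<open>kernel_power_mean\<close> its p-norm is of order at most (1 - a)^(1/p - 2), which the
  numerator offsets.\<close>

definition test_function :: "real \<Rightarrow> real \<Rightarrow> complex \<Rightarrow> complex" where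
  "test_function p a z = of_real ((1 - a) powr (2 - 1 / p)) / (1 - of_real a * z)\<^sup>2"

text \<open>For a < 1 this disc is larger than the unit disc, which later gives absolutely summable
  Taylor coefficients.\<close>

lemma test_function_holomorphic:
  assumes "0 < a"
  shows "test_function p a holomorphic_on ball 0 (1 / a)"
proof -
  have "1 - of_real a * z \<noteq> 0" if "z \<in> ball 0 (1 / a)" for z :: complex
  proof
    assume "1 - of_real a * z = 0"
    then have "norm (of_real a * z) = 1" by simp
    then show False using that assms by (simp add: norm_mult field_simps)
  qed
  then show ?thesis unfolding test_function_def by (intro holomorphic_intros) auto
qed

lemma test_function_hardy:
  assumes a: "0 < a" "a < 1" and p: "p \<ge> 1"
  shows "test_function p a \<in> hardy_space p" and "hardy_norm p (test_function p a) \<le> 1"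
proof -
  have hol: "test_function p a holomorphic_on ball 0 1"
    using a by (intro holomorphic_on_subset[OF test_function_holomorphic] subset_ball) auto
  have mean: "integral_mean p (test_function p a) r \<le> 1" if r: "0 < r" "r < 1" for r
  proof (rule integral_mean_leI[OF hol])
    let ?z = "of_real a * of_real r :: complex"
    have nz: "norm ?z = a * r" using a r by (simp add: norm_mult)
    have ar: "a * r \<le> a" using a r by (intro mult_right_le_one_le) auto
    have z: "norm ?z < 1" unfolding nz using ar a by linarith
    have eq: "norm (test_function p a (of_real r * cis \<theta>)) powr p
        = (1 - a) powr (2 * p - 1) * norm (1 - ?z * cis \<theta>) powr (- 2 * p)" for \<theta>
    proof -
      define D where "D = norm (1 - ?z * cis \<theta>)"
      have "norm (test_function p a (of_real r * cis \<theta>)) = (1 - a) powr (2 - 1 / p) / D\<^sup>2"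
        unfolding test_function_def D_def by (simp add: norm_divide norm_power mult.assoc)
      moreover have "D > 0" using norm_kernel_ge[of "cis \<theta>" ?z] z unfolding D_def norm_cis by linarith
      ultimately have "norm (test_function p a (of_real r * cis \<theta>)) = (1 - a) powr (2 - 1 / p) * D powr (- 2)"
        by (simp add: powr_minus powr_numeral divide_inverse)
      then show ?thesis
        using p by (simp add: powr_mult powr_powr left_diff_distrib D_def)
    qed
    have "(\<integral>\<theta>. norm (test_function p a (of_real r * cis \<theta>)) powr p \<partial>circle)
        \<le> (1 - a) powr (2 * p - 1) * (2 * pi * (1 - norm ?z) powr (1 - 2 * p))"
      unfolding eq integral_mult_right_zero by (intro mult_left_mono kernel_power_mean z p) auto
    also have "\<dots> \<le> (1 - a) powr (2 * p - 1) * (2 * pi * (1 - a) powr (1 - 2 * p))"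
      unfolding nz using a ar p by (intro mult_left_mono powr_mono2') auto
    also have "\<dots> = 2 * pi * ((1 - a) powr (2 * p - 1) * (1 - a) powr (1 - 2 * p))"
      by (simp only: mult_ac)
    also have "\<dots> = 2 * pi * 1 powr p"
      using a by (simp add: powr_add[symmetric])
    finally show "(\<integral>\<theta>. norm (test_function p a (of_real r * cis \<theta>)) powr p \<partial>circle) \<le> 2 * pi * 1 powr p" .
  qed (use r p in auto)
  show "test_function p a \<in> hardy_space p" "hardy_norm p (test_function p a) \<le> 1"
    using mean by (auto intro: hardy_spaceI[OF hol])
qed

lemma ex_subseq_ge_if_not_tendsto_0:
  fixes X :: "nat \<Rightarrow> real"
  assumes "\<And>n. X n \<ge> 0" "\<not> X \<longlonglongrightarrow> 0"
  obtains \<epsilon> r where "\<epsilon> > 0" "strict_mono (r :: nat \<Rightarrow> nat)" "\<And>n. \<epsilon> \<le> X (r n)"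
proof -
  obtain \<epsilon> where \<epsilon>: "\<epsilon> > 0" "\<not> eventually (\<lambda>n. X n < \<epsilon>) sequentially"
    using assms unfolding tendsto_iff by (auto simp: dist_real_def)
  then have "infinite {n. \<epsilon> \<le> X n}"
    by (simp add: cofinite_eq_sequentially[symmetric] eventually_cofinite not_less)
  then obtain r :: "nat \<Rightarrow> nat" where "strict_mono r" "\<And>n. r n \<in> {n. \<epsilon> \<le> X n}"
    using infinite_enumerate by blast
  then show thesis using \<epsilon>(1) by (intro that) auto
qed

context interval_measure
begin

text \<open>The sum of the absolute values of the Taylor coefficients is a constant majorant,
  integrable for every finite measure.\<close>

lemma DH_test_function:
  assumes a: "0 < a" "a < 1"
  shows "integrable \<mu> (\<lambda>t. test_function p a (of_real t))"
    and "norm z < 1 \<Longrightarrow> DH \<mu> (test_function p a) z = kernel_operator (\<lambda>t. test_function p a (of_real t)) z"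
proof -
  have hol: "test_function p a holomorphic_on ball 0 1"
    using a by (intro holomorphic_on_subset[OF test_function_holomorphic] subset_ball) auto
  have sm: "summable (\<lambda>k. norm (taylor_coeff (test_function p a) k))"
    using a by (intro taylor_coeff_abs_summable[OF test_function_holomorphic]) auto
  have le: "norm (taylor_coeff (test_function p a) k) * t ^ k \<le> norm (taylor_coeff (test_function p a) k)"
    if "t \<in> {0..<1}" for t k
    using that by (intro mult_right_le_one_le) (auto simp: power_le_one)
  have sm': "summable (\<lambda>k. norm (taylor_coeff (test_function p a) k) * t ^ k)" if "t \<in> {0..<1}" for t
    using that le[OF that] by (intro summable_comparison_test'[OF sm]) auto
  note rep = DH_eq_kernel_operator[OF hol, of "\<lambda>_. \<Sum>k. norm (taylor_coeff (test_function p a) k)",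
      OF _ suminf_le[OF le sm' sm] sm']
  show "integrable \<mu> (\<lambda>t. test_function p a (of_real t))"
    using rep(1) by simp
  show "norm z < 1 \<Longrightarrow> DH \<mu> (test_function p a) z = kernel_operator (\<lambda>t. test_function p a (of_real t)) z"
    using rep(2) by simp
qed

lemma test_function_of_real:
  assumes "0 < a" "a < 1" "0 \<le> t" "t < 1"
  shows "test_function p a (of_real t) = of_real ((1 - a) powr (2 - 1 / p) * (1 - a * t) powr (-2))"
proof -
  have "a * t \<le> a" using assms by (intro mult_right_le_one_le) auto
  then have "1 - a * t > 0" using assms by linarith
  then show ?thesis
    by (simp add: test_function_def powr_minus powr_numeral divide_inverse)
qed

text \<open>With 1/p < \<eta> < 1 the factor (1 - a t)^(-2) is split into the exponents \<eta> - 2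
  and -\<eta>, the first estimated by 1 - a and the second by 1 - t. The condition \<eta> < 1 makes
  (1 - t)^(-\<eta>) integrable for a 1-Carleson measure, and \<eta> > 1/p leaves a positive power of
  1 - a.\<close>

lemma DH_test_function_tendsto_0:
  assumes p: "p > 1" and car: "carleson 1 \<mu>" and z: "norm z < 1"
  shows "((\<lambda>a. DH \<mu> (test_function p a) z) \<longlongrightarrow> 0) (at_left 1)"
proof -
  have "1 / p < 1" "1 / p > 0" using p by simp_all
  then obtain \<eta> where \<eta>: "1 / p < \<eta>" "\<eta> < 1" "0 \<le> \<eta>"
    using dense[of "1 / p" 1] by force
  define W where "W = (\<integral>t. (1 - t) powr (- \<eta>) \<partial>\<mu>)"
  have w: "integrable \<mu> (\<lambda>t. (1 - t) powr (- \<eta>))" using integrable_weight[OF car \<eta>(3,2)] .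
  have le: "norm (DH \<mu> (test_function p a) z) \<le> (1 - a) powr (\<eta> - 1 / p) * (W / (1 - norm z)\<^sup>2)"
    if a: "0 < a" "a < 1" for a
  proof -
    have pt: "norm (test_function p a (of_real t)) \<le> (1 - a) powr (\<eta> - 1 / p) * (1 - t) powr (- \<eta>)"
      if t: "t \<in> {0..<1}" for t
    proof -
      have at: "a * t \<le> a" "a * t \<le> t" using a t by (auto intro: mult_right_le_one_le mult_left_le_one_le)
      have "norm (test_function p a (of_real t)) = (1 - a) powr (2 - 1 / p) * (1 - a * t) powr (-2)"
        using a t test_function_of_real[of a t p] by (simp del: of_real_mult)
      also have "(1 - a * t) powr (-2) = (1 - a * t) powr (\<eta> - 2) * (1 - a * t) powr (- \<eta>)"
        by (simp add: powr_add[symmetric])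
      also have "\<dots> \<le> (1 - a) powr (\<eta> - 2) * (1 - t) powr (- \<eta>)"
        using a t at \<eta> by (intro mult_mono powr_mono2') auto
      also have "(1 - a) powr (2 - 1 / p) * \<dots> = (1 - a) powr (\<eta> - 1 / p) * (1 - t) powr (- \<eta>)"
        by (simp add: mult.assoc[symmetric] powr_add[symmetric])
      finally show ?thesis by (simp add: mult_left_mono)
    qed
    have "norm (DH \<mu> (test_function p a) z) \<le> (\<integral>t. norm (test_function p a (of_real t)) \<partial>\<mu>) / (1 - norm z)\<^sup>2"
      using kernel_integrable(2)[OF DH_test_function(1)[OF a] z] DH_test_function(2)[OF a z] by simp
    also have "\<dots> \<le> (\<integral>t. (1 - a) powr (\<eta> - 1 / p) * (1 - t) powr (- \<eta>) \<partial>\<mu>) / (1 - norm z)\<^sup>2"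
      using pt by (intro divide_right_mono integral_mono integrable_norm DH_test_function(1)[OF a] integrable_mult_right w) auto
    finally show ?thesis by (simp add: W_def)
  qed
  have "((\<lambda>a. (1 - a) powr (\<eta> - 1 / p) * (W / (1 - norm z)\<^sup>2)) \<longlongrightarrow> 0 * (W / (1 - norm z)\<^sup>2)) (at_left 1)"
  proof (intro tendsto_mult tendsto_const)
    have "((\<lambda>a. 1 - a) \<longlongrightarrow> (0::real)) (at_left 1)"
      by (auto intro!: tendsto_eq_intros)
    moreover have "eventually (\<lambda>a. 0 \<le> 1 - a) (at_left (1::real))"
      by (auto simp: eventually_at_filter)
    ultimately show "((\<lambda>a. (1 - a) powr (\<eta> - 1 / p)) \<longlongrightarrow> 0) (at_left 1)"
      using tendsto_powr'[of "\<lambda>a. 1 - a" 0 "at_left 1" "\<lambda>_. \<eta> - 1 / p" "\<eta> - 1 / p"] \<eta> by simp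
  qed
  then have lim: "((\<lambda>a. (1 - a) powr (\<eta> - 1 / p) * (W / (1 - norm z)\<^sup>2)) \<longlongrightarrow> 0) (at_left 1)"
    by simp
  have "eventually (\<lambda>a. a \<in> {0<..<1}) (at_left (1::real))"
    by (intro eventually_at_left_real) auto
  then have "eventually (\<lambda>a. norm (DH \<mu> (test_function p a) z)
      \<le> (1 - a) powr (\<eta> - 1 / p) * (W / (1 - norm z)\<^sup>2)) (at_left 1)"
    by (rule eventually_mono) (use le in auto)
  then show ?thesis using lim by (rule Lim_null_comparison)
qed

text \<open>At z = a the integrand is positive, so the integral over [0,1) dominates the one over
  [a,1). There 1 - a t <= 1 - a^2 <= 2 (1 - a), and the fourth power of the 2 gives the 16.\<close>

lemma tail_le_DH_test_function:
  assumes a: "0 < a" "a < 1"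
  shows "measure \<mu> {a..<1} \<le> 16 * (1 - a) powr (2 + 1 / p) * norm (DH \<mu> (test_function p a) (of_real a))"
proof -
  define G where "G = (\<lambda>t. (1 - a) powr (2 - 1 / p) * (1 - a * t) powr (-4))"
  have na: "norm (of_real a :: complex) < 1" using a by simp
  have pos: "1 - a * t > 0" if "t \<in> {0..<1}" for t
  proof -
    have "a * t \<le> a" using a that by (intro mult_right_le_one_le) auto
    then show ?thesis using a by linarith
  qed
  have eq: "test_function p a (of_real t) / (1 - of_real t * of_real a)\<^sup>2 = of_real (G t)" if t: "t \<in> {0..<1}" for t
  proof -
    have "of_real (G t) = (of_real ((1 - a) powr (2 - 1 / p) * (1 - a * t) powr (-2) * (1 - a * t) powr (-2)) :: complex)"
      by (simp add: G_def mult.assoc powr_add[symmetric])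
    also have "\<dots> = test_function p a (of_real t) * of_real ((1 - a * t) powr (-2))"
      using a t by (simp only: test_function_of_real of_real_mult atLeastLessThan_iff)
    also have "of_real ((1 - a * t) powr (-2)) = 1 / (1 - of_real t * of_real a :: complex)\<^sup>2"
      using pos[OF t] by (simp add: powr_minus powr_numeral divide_inverse mult.commute)
    finally show ?thesis by simp
  qed
  have "integrable \<mu> (\<lambda>t. complex_of_real (G t))"
    using kernel_integrable(1)[OF DH_test_function(1)[OF a] na, of p] eq
    by (subst (asm) Bochner_Integration.integrable_cong[OF refl]) auto
  then have intG: "integrable \<mu> G" by (simp only: complex_of_real_integrable_eq)
  have "DH \<mu> (test_function p a) (of_real a) = (\<integral>t. of_real (G t) \<partial>\<mu>)"
    unfolding DH_test_function(2)[OF a na] kernel_operator_def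
    using eq by (intro Bochner_Integration.integral_cong) auto
  then have DH: "norm (DH \<mu> (test_function p a) (of_real a)) = \<bar>\<integral>t. G t \<partial>\<mu>\<bar>"
    by simp
  \<comment> \<open>The lower bound of \<open>G\<close> on [a,1), equal to the reciprocal of 16 (1 -
    a)^(2 + 1/p).\<close>
  define c where "c = (1 - a) powr (2 - 1 / p) * (2 * (1 - a)) powr (-4)"
  have "c * measure \<mu> {a..<1} = (\<integral>t. c * indicator {a..<1} t \<partial>\<mu>)"
    using a tail_in_sets[of a] by (simp add: emeasure_eq_measure)
  also have "\<dots> \<le> (\<integral>t. G t \<partial>\<mu>)"
  proof (intro integral_mono intG)
    show "integrable \<mu> (\<lambda>t. c * indicator {a..<1} t)"
      using a tail_in_sets[of a] by (intro integrable_mult_right integrable_real_indicator) (auto simp: emeasure_eq_measure)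
    fix t assume "t \<in> space \<mu>"
    then have t: "t \<in> {0..<1}" by simp
    show "c * indicator {a..<1} t \<le> G t"
    proof (cases "a \<le> t")
      case True
      have "a * a \<le> a * t" using a True by (intro mult_left_mono) auto
      moreover have "1 - a * a \<le> 2 * (1 - a)"
        using zero_le_power2[of "1 - a"] by (simp add: power2_eq_square algebra_simps)
      ultimately have "1 - a * t \<le> 2 * (1 - a)" by linarith
      then have "c \<le> G t"
        unfolding c_def G_def using pos[OF t] by (intro mult_left_mono powr_mono2') auto
      then show ?thesis using True t by simp
    qed (simp add: G_def)
  qed
  also have "\<dots> \<le> norm (DH \<mu> (test_function p a) (of_real a))" unfolding DH by simp
  finally have "16 * (1 - a) powr (2 + 1 / p) * (c * measure \<mu> {a..<1})
      \<le> 16 * (1 - a) powr (2 + 1 / p) * norm (DH \<mu> (test_function p a) (of_real a))"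
    by (intro mult_left_mono) auto
  moreover have "16 * (1 - a) powr (2 + 1 / p) * c = 1"
  proof -
    have "16 * (1 - a) powr (2 + 1 / p) * c = 16 * 2 powr (-4) * ((1 - a) powr (2 + 1 / p) * ((1 - a) powr (2 - 1 / p) * (1 - a) powr (-4)))"
      unfolding c_def using a by (subst powr_mult) auto
    also have "\<dots> = 1"
      using a by (simp only: powr_add[symmetric]) (simp add: powr_minus powr_numeral)
    finally show ?thesis .
  qed
  ultimately show ?thesis by (simp only: mult.assoc[symmetric] mult_1)
qed

lemma vanishing_carleson_if_DH_compact:
  assumes p: "1 < p" "p \<le> q" and car: "carleson 1 \<mu>"
    and comp: "compact_operator_hardy p q (DH \<mu>)"
  shows "vanishing_carleson (1 / p + 2 - 1 / q) \<mu>"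
proof -
  have p1: "p \<ge> 1" and q1: "q \<ge> 1" using p by auto
  define \<sigma> where "\<sigma> = 1 / p + 2 - 1 / q"
  let ?T = "\<lambda>a. DH \<mu> (test_function p a)"
  have maps: "DH \<mu> f \<in> hardy_space q" if "f \<in> hardy_space p" for f
    using comp that unfolding compact_operator_hardy_def by blast
  have Tq: "?T a \<in> hardy_space q" if "0 < a" "a < 1" for a
    using that p1 by (intro maps test_function_hardy)
  have norm_lim: "((\<lambda>a. hardy_norm q (?T a)) \<longlongrightarrow> 0) (at_left 1)"
  \<comment> \<open>The lower bound 0 keeps the sequences in (0,1), where the test functions lie in
    the unit ball of H^p.\<close>
  proof (rule tendsto_at_left_sequentially[of 0])
    fix S :: "nat \<Rightarrow> real"
    assume S: "\<And>n. S n < 1" "\<And>n. 0 < S n" "S \<longlonglongrightarrow> 1"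
    show "(\<lambda>n. hardy_norm q (?T (S n))) \<longlonglongrightarrow> 0"
    proof (rule ccontr)
      assume "\<not> (\<lambda>n. hardy_norm q (?T (S n))) \<longlonglongrightarrow> 0"
      then obtain \<epsilon> r where \<epsilon>: "\<epsilon> > 0" and r: "strict_mono (r :: nat \<Rightarrow> nat)"
        and ge: "\<And>n. \<epsilon> \<le> hardy_norm q (?T (S (r n)))"
        using ex_subseq_ge_if_not_tendsto_0[of "\<lambda>n. hardy_norm q (?T (S n))"] hardy_norm_nonneg[OF Tq] S by metis
      define F where "F = (\<lambda>n. test_function p (S (r n)))"
      have F: "\<And>n. F n \<in> hardy_space p" "\<And>n. hardy_norm p (F n) \<le> 1"
        unfolding F_def using S p1 by (auto intro: test_function_hardy)
      then obtain r' g where r': "strict_mono r'" and g: "g \<in> hardy_space q"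
        and lim: "(\<lambda>n. hardy_norm q (\<lambda>z. DH \<mu> (F (r' n)) z - g z)) \<longlonglongrightarrow> 0"
        using comp unfolding compact_operator_hardy_def by blast
      \<comment> \<open>By the growth estimate, convergence in H^q implies pointwise convergence on
        the disc, and the pointwise limit of the images is 0. Thus the norms along the subsequence
        tend to 0, against the lower bound \<epsilon>.\<close>
      have g0: "g z = 0" if z: "z \<in> ball 0 1" for z
      proof -
        have z': "norm z < 1" using z by simp
        have "(\<lambda>n. S (r (r' n))) \<longlonglongrightarrow> 1"
          using LIMSEQ_subseq_LIMSEQ[OF S(3) strict_mono_o[OF r r']] by (simp add: o_def)
        then have "filterlim (\<lambda>n. S (r (r' n))) (at_left 1) sequentially"
          using S(1) by (auto simp: filterlim_at less_imp_neq)
        then have 1: "(\<lambda>n. DH \<mu> (F (r' n)) z) \<longlonglongrightarrow> 0"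
          unfolding F_def using filterlim_compose[OF DH_test_function_tendsto_0[OF p(1) car z']] by blast
        have "(\<lambda>n. DH \<mu> (F (r' n)) z - g z) \<longlonglongrightarrow> 0"
        proof (rule Lim_null_comparison)
          show "\<forall>\<^sub>F n in sequentially. norm (DH \<mu> (F (r' n)) z - g z)
              \<le> (2 / (1 - norm z)) powr (1 / q) * hardy_norm q (\<lambda>z. DH \<mu> (F (r' n)) z - g z)"
          proof (intro always_eventually allI norm_le_hardy_norm[of "\<lambda>z. DH \<mu> (F (r' _)) z - g z"] q1 z')
            show "(\<lambda>z. DH \<mu> (F (r' n)) z - g z) \<in> hardy_space q" for n
              using hardy_space_lincomb[OF maps[OF F(1)[of "r' n"]] g, of 1 "-1"] q1 by simp
          qed
          show "(\<lambda>n. (2 / (1 - norm z)) powr (1 / q) * hardy_norm q (\<lambda>z. DH \<mu> (F (r' n)) z - g z)) \<longlonglongrightarrow> 0"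
            using tendsto_mult_right_zero[OF lim] by simp
        qed
        from tendsto_diff[OF 1 this] show ?thesis
          by (simp add: LIMSEQ_const_iff)
      qed
      have "hardy_norm q (\<lambda>z. DH \<mu> (F (r' n)) z - g z) = hardy_norm q (DH \<mu> (F (r' n)))" for n
        by (rule hardy_cong(2)) (simp add: g0)
      then have "(\<lambda>n. hardy_norm q (?T (S (r (r' n))))) \<longlonglongrightarrow> 0"
        using lim by (simp add: F_def)
      then have "\<epsilon> \<le> 0" by (rule LIMSEQ_le_const) (use ge in auto)
      then show False using \<epsilon> by simp
    qed
  qed simp
  have bound: "measure \<mu> {a..<1} / (1 - a) powr \<sigma> \<le> 16 * 2 powr (1 / q) * hardy_norm q (?T a)"
    if a: "0 < a" "a < 1" for a
  proof -
    have "norm (?T a (of_real a)) \<le> (2 / (1 - a)) powr (1 / q) * hardy_norm q (?T a)"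
      using norm_le_hardy_norm[OF Tq[OF a] q1, of "of_real a"] a by simp
    then have "16 * (1 - a) powr (2 + 1 / p) * norm (?T a (of_real a))
        \<le> 16 * (1 - a) powr (2 + 1 / p) * ((2 / (1 - a)) powr (1 / q) * hardy_norm q (?T a))"
      by (intro mult_left_mono) auto
    \<comment> \<open>The exponents combine as (2 + 1/p) - 1/q = \<sigma>.\<close>
    also have "\<dots> = 16 * 2 powr (1 / q) * hardy_norm q (?T a) * (1 - a) powr \<sigma>"
    proof -
      have "(1 - a) powr (2 + 1 / p) * (2 / (1 - a)) powr (1 / q) = 2 powr (1 / q) * (1 - a) powr \<sigma>"
        using a by (simp add: \<sigma>_def powr_divide powr_add powr_diff)
      then show ?thesis by simp
    qed
    finally have "measure \<mu> {a..<1} \<le> 16 * 2 powr (1 / q) * hardy_norm q (?T a) * (1 - a) powr \<sigma>"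
      using tail_le_DH_test_function[OF a, of p] by linarith
    then show ?thesis using a by (simp add: divide_le_eq)
  qed
  have ev01: "eventually (\<lambda>a. a \<in> {0<..<1}) (at_left (1::real))"
    by (intro eventually_at_left_real) auto
  have van: "((\<lambda>t. measure \<mu> {t..<1} / (1 - t) powr \<sigma>) \<longlongrightarrow> 0) (at_left 1)"
  proof (rule tendsto_sandwich[OF _ _ tendsto_const])
    show "((\<lambda>a. 16 * 2 powr (1 / q) * hardy_norm q (?T a)) \<longlongrightarrow> 0) (at_left 1)"
      using tendsto_mult_right_zero[OF norm_lim] by simp
    show "\<forall>\<^sub>F t in at_left 1. measure \<mu> {t..<1} / (1 - t) powr \<sigma> \<le> 16 * 2 powr (1 / q) * hardy_norm q (?T t)"
      using ev01 by (rule eventually_mono) (use bound in auto)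
  qed (use ev01 in \<open>auto intro!: always_eventually\<close>)
  have "carleson \<sigma> \<mu>"
  proof -
    have "eventually (\<lambda>t. measure \<mu> {t..<1} / (1 - t) powr \<sigma> < 1) (at_left 1)"
      using van by (rule order_tendstoD) simp
    then obtain b where b: "b < 1" "\<And>t. b < t \<Longrightarrow> t < 1 \<Longrightarrow> measure \<mu> {t..<1} / (1 - t) powr \<sigma> < 1"
      unfolding eventually_at_left[OF zero_less_one] by blast
    have "1 / q \<le> 1" using q1 by simp
    moreover have "1 / p > 0" using p by simp
    ultimately have \<sigma>0: "\<sigma> \<ge> 0" unfolding \<sigma>_def by linarith
    \<comment> \<open>The summand 1 serves for t > b, where the quotient is below 1. For t <= b the
      total mass is compared with (1 - b)^\<sigma>, which is at most (1 - t)^\<sigma> because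
      \<sigma> >= 0.\<close>
    define C where "C = 1 + measure \<mu> (space \<mu>) / (1 - b) powr \<sigma>"
    have C: "C \<ge> 1" by (simp add: C_def)
    have "measure \<mu> {t..<1} \<le> C * (1 - t) powr \<sigma>" if t: "t \<in> {0..<1}" for t
    proof (cases "b < t")
      case True
      then have "measure \<mu> {t..<1} \<le> 1 * (1 - t) powr \<sigma>"
        using b(2)[of t] t by (simp add: divide_less_eq)
      also have "\<dots> \<le> C * (1 - t) powr \<sigma>" using C by (intro mult_right_mono) auto
      finally show ?thesis .
    next
      case False
      have "measure \<mu> {t..<1} \<le> measure \<mu> (space \<mu>)" by (rule bounded_measure)
      also have "\<dots> = measure \<mu> (space \<mu>) / (1 - b) powr \<sigma> * (1 - b) powr \<sigma>" using b(1) by simp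
      also have "\<dots> \<le> C * (1 - t) powr \<sigma>"
        using False b(1) \<sigma>0 C by (intro mult_mono powr_mono2) (auto simp: C_def)
      finally show ?thesis .
    qed
    then show ?thesis
      unfolding carleson_def using C
      by (intro exI[of _ C]) (auto simp: emeasure_eq_measure intro!: ennreal_leI)
  qed
  then show ?thesis using van unfolding vanishing_carleson_def \<sigma>_def by simp
qed

end

theorem theorem5p2:
  fixes p q q' :: real and \<mu> :: "real measure"
  assumes "1 < p" and "p \<le> q" and "1 / q + 1 / q' = 1"
    and "sets \<mu> = sets (restrict_space borel {0..<1})"
    and "carleson 1 \<mu>"
  shows "(\<forall>\<gamma>>0. vanishing_carleson (1 / p + 1 / q' + 1 + \<gamma>) \<mu> \<longrightarrow>
            compact_operator_hardy p q (DH \<mu>)) \<and>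
         (compact_operator_hardy p q (DH \<mu>) \<longrightarrow>
            vanishing_carleson (1 / p + 1 / q' + 1) \<mu>)"
proof -
  have space: "space \<mu> = {0..<1}"
    using sets_eq_imp_space_eq[OF assms(4)] by (simp add: space_restrict_space)
  obtain C where "emeasure \<mu> {0..<1} \<le> ennreal (C * (1 - 0) powr 1)"
    using assms(5) unfolding carleson_def by force
  then have "emeasure \<mu> (space \<mu>) < \<infinity>"
    unfolding space infinity_ennreal_def by (rule le_less_trans) (rule ennreal_less_top)
  then interpret finite_measure \<mu> by (intro finite_measureI) auto
  interpret interval_measure \<mu> by unfold_locales (rule assms(4))
  have q': "1 / q' = 1 - 1 / q" using assms(3) by simp
  have eq: "1 / p + 1 / q' + 1 = 1 / p + 2 - 1 / q" unfolding q' by simp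
  show ?thesis
    unfolding eq
  proof (intro conjI allI impI)
    fix \<gamma> :: real
    assume "\<gamma> > 0" "vanishing_carleson (1 / p + 2 - 1 / q + \<gamma>) \<mu>"
    then show "compact_operator_hardy p q (DH \<mu>)"
      by (intro DH_compact_if_carleson[OF assms(1,2)]) (auto simp: vanishing_carleson_def)
  next
    assume "compact_operator_hardy p q (DH \<mu>)"
    then show "vanishing_carleson (1 / p + 2 - 1 / q) \<mu>"
      by (rule vanishing_carleson_if_DH_compact[OF assms(1,2,5)])
  qed
qed

end
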